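(* Let $n\ge 1$ and let $f:\mathbb{D}^n\to\mathbb{D}$ be a holomorphic function which depends on all $n$ variables, i.e. none of the partial derivatives $\frac{\partial f}{\partial z_1},\dots,\frac{\partial f}{\partial z_n}$ is identically zero on $\mathbb{D}^n$. Then $f$ satisfies $$\sum_{i=1}^{n}(1-|z_i|^2)\left|\frac{\partial f}{\partial z_i}(z)\right| = 1-|f(z)|^2$$ for every $z=(z_1,\dots,z_n)\in\mathbb{D}^n$ if and only if there is an $(n+1)\times(n+1)$ complex matrix $U$ which is unitary and symmetric (i.e. $U^*=U^{-1}$ and $U=U^t$), written in block form with respect to $\mathbb{C}^{n+1}=\mathbb{C}\oplus\mathbb{C}^n$ as $$U=\begin{pmatrix} A & B\\ C & D\end{pmatrix}$$ (so $A$ is $1\times 1$, $B$ is $1\times n$, $C$ is $n\times 1$, $D$ is $n\times n$), such that $$f(z)=A+BE_z(I-DE_z)^{-1}C\qquad\text{for all } z\in\mathbb{D}^n,$$ where $E_z$ is the $n\times n$ diagonal matrix with diagonal entries $z_1,z_2,\dots,z_n$. Moreover, such functions $f$ are rational and inner.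
   Context: $\mathbb{D}=\{\zeta\in\mathbb{C}:|\zeta|<1\}$ is the open unit disk and $\mathbb{D}^n=\mathbb{D}\times\cdots\times\mathbb{D}$ is the polydisk. $U^t$ denotes the transpose (without conjugation) and $U^*$ the conjugate transpose. A bounded holomorphic function on $\mathbb{D}^n$ is inner if its radial boundary values have modulus $1$ at almost every point of the torus $\{z\in\mathbb{C}^n: |z_1|=\cdots=|z_n|=1\}$. *)

theory Defs
  imports "HOL-Complex_Analysis.Complex_Analysis"
begin

definition polydisk :: "(complex^'n) set"
  where "polydisk = {z. \<forall>i. cmod (z $ i) < 1}"

text \<open>Complex differentiability: the real Frechet derivative exists and is
  \<open>\<complex>\<close>-linear.\<close>

definition holomorphic_vec_on :: "(complex^'n \<Rightarrow> complex) \<Rightarrow> (complex^'n) set \<Rightarrow> bool"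
    (infixl \<open>(holomorphic'_vec'_on)\<close> 50)
  where "f holomorphic_vec_on S \<longleftrightarrow>
    (\<forall>z\<in>S. \<exists>F. (f has_derivative F) (at z within S) \<and> (\<forall>c v. F (c *s v) = c * F v))"

definition partial_deriv :: "'n \<Rightarrow> (complex^'n \<Rightarrow> complex) \<Rightarrow> complex^'n \<Rightarrow> complex"
  where "partial_deriv i f z = deriv (\<lambda>w. f (\<chi> j. if j = i then w else z $ j)) (z $ i)"

definition conj_transpose :: "complex^'n^'m \<Rightarrow> complex^'m^'n"
  where "conj_transpose M = (\<chi> i j. cnj (M $ j $ i))"

definition unitary_matrix :: "complex^'n^'n \<Rightarrow> bool"
  where "unitary_matrix U \<longleftrightarrow>
    conj_transpose U ** U = mat 1 \<and> U ** conj_transpose U = mat 1"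

definition diag_matrix :: "complex^'n \<Rightarrow> complex^'n^'n"
  where "diag_matrix z = (\<chi> i j. if i = j then z $ i else 0)"

text \<open>The index type \<open>1 + 'n\<close> reflects the splitting of \<open>\<complex>\<^bsup>n+1\<^esup>\<close> as \<open>\<complex> \<oplus> \<complex>\<^bsup>n\<^esup>\<close>.\<close>

definition block_matrix ::
    "complex^1^1 \<Rightarrow> complex^'n^1 \<Rightarrow> complex^1^'n \<Rightarrow> complex^'n^'n \<Rightarrow> complex^(1 + 'n)^(1 + 'n)"
  where "block_matrix A B C D = (\<chi> i j.
    case i of
      Inl a \<Rightarrow> (case j of Inl b \<Rightarrow> A $ a $ b | Inr b \<Rightarrow> B $ a $ b)
    | Inr a \<Rightarrow> (case j of Inl b \<Rightarrow> C $ a $ b | Inr b \<Rightarrow> D $ a $ b))"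

definition complex_polynomial :: "(complex^'n \<Rightarrow> complex) \<Rightarrow> bool"
  where "complex_polynomial p \<longleftrightarrow>
    (\<exists>(S :: ('n \<Rightarrow> nat) set) c. finite S \<and>
       (\<forall>z. p z = (\<Sum>\<alpha>\<in>S. c \<alpha> * (\<Prod>i\<in>UNIV. (z $ i) ^ \<alpha> i))))"

definition rational_on :: "(complex^'n \<Rightarrow> complex) \<Rightarrow> (complex^'n) set \<Rightarrow> bool"
  where "rational_on f S \<longleftrightarrow>
    (\<exists>p q. complex_polynomial p \<and> complex_polynomial q \<and>
       (\<forall>z\<in>S. q z \<noteq> 0 \<and> f z = p z / q z))"

text \<open>Unnormalized Haar measure on the torus, as the image of Lebesgue measure on
  \<open>[0, 2\<pi>]\<^bsup>n\<^esup>\<close>; it is carried by the points all of whose coordinates are unimodular.\<close>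

definition torus_measure :: "(complex^'n) measure"
  where "torus_measure =
    distr (restrict_space lborel (cbox 0 (\<chi> i. 2 * pi))) borel
      (\<lambda>\<theta> :: real^'n. \<chi> i. cis (\<theta> $ i))"

definition inner_function :: "(complex^'n \<Rightarrow> complex) \<Rightarrow> bool"
  where "inner_function f \<longleftrightarrow>
    f holomorphic_vec_on polydisk \<and> bounded (f ` polydisk) \<and>
    (AE \<zeta> in torus_measure. \<exists>L. ((\<lambda>r::real. f (r *\<^sub>R \<zeta>)) \<longlongrightarrow> L) (at_left 1) \<and> cmod L = 1)"

lemma norm_unitary_mult:
  fixes U :: "complex^'m^'m"
  assumes "unitary_matrix U"
  shows "norm (U *v x) = norm x"
proof -
  have sq: "complex_of_real ((norm y)\<^sup>2) = (\<Sum>i\<in>UNIV. cnj (y $ i) * y $ i)" for y :: "complex^'m"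
    by (simp add: norm_vec_def L2_set_def sum_nonneg complex_norm_square mult.commute
        del: of_real_power)
  have adj: "(\<Sum>i\<in>UNIV. cnj ((U *v x) $ i) * y $ i)
      = (\<Sum>i\<in>UNIV. cnj (x $ i) * (conj_transpose U *v y) $ i)" for y
    by (simp add: matrix_vector_mult_def conj_transpose_def sum_distrib_left sum_distrib_right,
        subst sum.swap, simp add: mult_ac)
  have "complex_of_real ((norm (U *v x))\<^sup>2) = complex_of_real ((norm x)\<^sup>2)"
    unfolding sq adj using assms
    by (simp add: matrix_vector_mul_assoc unitary_matrix_def)
  hence "(norm (U *v x))\<^sup>2 = (norm x)\<^sup>2"
    using of_real_eq_iff by blast
  thus ?thesis by simp
qed

text \<open>The inverse in the realization formula is a genuine one.\<close>

lemma invertible_realization: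
  fixes D :: "complex^'n^'n"
  assumes U: "unitary_matrix (block_matrix A B C D)" and z: "z \<in> polydisk"
  shows "invertible (mat 1 - D ** diag_matrix z)"
proof -
  have UNIV_sum: "(\<Sum>i\<in>UNIV. h i) = (\<Sum>i\<in>UNIV. h (Inl i)) + (\<Sum>i\<in>UNIV. h (Inr i))"
    for h :: "1 + 'n \<Rightarrow> 'b::comm_monoid_add"
    by (simp add: UNIV_Plus_UNIV[symmetric] sum.Plus comp_def del: UNIV_Plus_UNIV)
  have D_le: "norm (D *v y) \<le> norm y" for y
  proof -
    define v :: "complex^(1 + 'n)" where "v = (\<chi> i. case i of Inl a \<Rightarrow> 0 | Inr b \<Rightarrow> y $ b)"
    let ?w = "block_matrix A B C D *v v"
    have nv: "norm v = norm y"
      by (simp add: norm_vec_def L2_set_def UNIV_sum v_def)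
    have w: "?w $ Inr i = (D *v y) $ i" for i
      by (simp add: matrix_vector_mult_def block_matrix_def UNIV_sum v_def)
    have "norm (D *v y) \<le> norm ?w"
      unfolding norm_vec_def L2_set_def UNIV_sum w
      by (intro real_sqrt_le_mono) (simp add: sum_nonneg)
    thus ?thesis using norm_unitary_mult[OF U, of v] nv by simp
  qed
  have "x = 0" if "(mat 1 - D ** diag_matrix z) *v x = 0" for x
  proof (rule ccontr)
    assume "x \<noteq> 0"
    then obtain k where k: "x $ k \<noteq> 0" by (auto simp: vec_eq_iff)
    let ?y = "diag_matrix z *v x"
    have y: "?y $ i = z $ i * x $ i" for i
      by (simp add: matrix_vector_mult_def diag_matrix_def if_distrib if_distribR cong: if_cong)
    have zi: "cmod (z $ i) < 1" for i using z by (simp add: polydisk_def)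
    have "norm ?y < norm x"
      unfolding norm_vec_def L2_set_def y
    proof (intro real_sqrt_less_mono sum_strict_mono_ex1 ballI bexI[of _ k])
      show "(norm (z $ i * x $ i))\<^sup>2 \<le> (norm (x $ i))\<^sup>2" for i
        using zi[of i] by (intro power_mono) (auto simp: norm_mult intro: mult_left_le_one_le)
      show "(norm (z $ k * x $ k))\<^sup>2 < (norm (x $ k))\<^sup>2"
        using zi[of k] k by (intro power_strict_mono) (auto simp: norm_mult)
    qed auto
    moreover have "x = D *v ?y"
      using that by (simp add: matrix_vector_mult_diff_rdistrib matrix_vector_mul_assoc)
    ultimately show False using D_le[of ?y] by simp
  qed
  thus ?thesis
    by (simp add: invertible_left_inverse matrix_left_invertible_ker)
qed

end

theory Submission
  imports Defs
begin

text \<open>Near a point where no partial derivative vanishes, put \<open>h\<^sub>i = \<surd>(\<partial>\<^sub>i f)\<close>. The identity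
  becomes \<open>1 - |f|\<^sup>2 = \<Sum> (1 - |z\<^sub>i|\<^sup>2) |h\<^sub>i|\<^sup>2\<close> and polarizes, so that
  \<open>a(z) = (1, E\<^sub>z h(z)) \<mapsto> b(z) = (f(z), h(z))\<close> preserves inner products. A contractive linear
  extension of this map realizes \<open>f\<close>, and comparing the derivative of that realization with
  \<open>\<partial>\<^sub>i f = h\<^sub>i\<^sup>2\<close> yields \<open>f(z) - f(w) = \<Sum> h\<^sub>i(w) (z\<^sub>i - w\<^sub>i) h\<^sub>i(z)\<close>, that is, the bilinear
  product of \<open>a(z)\<close> and \<open>b(w)\<close> is symmetric in \<open>z\<close> and \<open>w\<close>. Under this condition the isometry
  extends to a symmetric unitary matrix. Conversely, for a symmetric unitary realization the same
  difference formula gives \<open>\<partial>\<^sub>i f = h\<^sub>i\<^sup>2\<close>, and unitarity gives the identity. The boundary values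
  are unimodular off the zeros of \<open>det (I - D E\<^sub>z)\<close>, a null set of the torus.\<close>

no_notation fps_nth (infixl \<open>$\<close> 75)

section \<open>Symmetric unitary interpolation\<close>

lemma sum_UNIV_Plus:
  fixes h :: "'a::finite + 'b::finite \<Rightarrow> 'c::comm_monoid_add"
  shows "(\<Sum>i\<in>UNIV. h i) = (\<Sum>i\<in>UNIV. h (Inl i)) + (\<Sum>i\<in>UNIV. h (Inr i))"
  by (simp add: UNIV_Plus_UNIV[symmetric] sum.Plus comp_def del: UNIV_Plus_UNIV)

definition conj_vec :: "complex^'n \<Rightarrow> complex^'n"
  where "conj_vec x = (\<chi> i. cnj (x $ i))"

definition cdot :: "complex^'n \<Rightarrow> complex^'n \<Rightarrow> complex"
  where "cdot x y = (\<Sum>i\<in>UNIV. x $ i * y $ i)"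

abbreviation cinner :: "complex^'n \<Rightarrow> complex^'n \<Rightarrow> complex"
  where "cinner x y \<equiv> cdot x (conj_vec y)"

lemma scaleR_eq_of_real_smult: "r *\<^sub>R x = of_real r *s x" for x :: "complex^'n"
  by (simp add: vec_eq_iff complex_eq_iff)

lemma conj_vec_simps [simp]:
  "conj_vec x $ i = cnj (x $ i)"
  "conj_vec (x + y) = conj_vec x + conj_vec y"
  "conj_vec (c *s x) = cnj c *s conj_vec x"
  "conj_vec (conj_vec x) = x"
  "conj_vec 0 = 0"
  by (simp_all add: conj_vec_def vec_eq_iff)

lemma norm_conj_vec [simp]: "norm (conj_vec x) = norm x"
  by (simp add: norm_vec_def)

lemma cdot_simps:
  "cdot (x + y) z = cdot x z + cdot y z"
  "cdot x (y + z) = cdot x y + cdot x z"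
  "cdot (c *s x) y = c * cdot x y"
  "cdot x (c *s y) = c * cdot x y"
  "cdot x (- y) = - cdot x y"
  "cdot x 0 = 0" "cdot 0 x = 0"
  by (simp_all add: cdot_def sum.distrib sum_subtractf sum_negf sum_distrib_left algebra_simps)

lemma cdot_commute: "cdot x y = cdot y x"
  by (simp add: cdot_def mult.commute)

lemma cnj_cdot: "cnj (cdot x y) = cdot (conj_vec x) (conj_vec y)"
  by (simp add: cdot_def)

lemma cinner_commute: "cinner y x = cnj (cinner x y)"
  by (simp add: cnj_cdot cdot_commute)

lemma inner_eq_Re_cinner: "x \<bullet> y = Re (cinner x y)" for x :: "complex^'n"
  by (simp add: inner_vec_def cdot_def inner_complex_def)

lemma cinner_self: "cinner x x = complex_of_real ((norm x)\<^sup>2)"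
  by (simp add: cdot_def norm_vec_def L2_set_def sum_nonneg complex_norm_square del: of_real_power)

lemma cdot_transpose: "cdot (transpose M *v x) y = cdot x (M *v y)"
  by (simp add: cdot_def matrix_vector_mult_def transpose_def sum_distrib_left sum_distrib_right)
     (subst sum.swap, simp add: mult_ac)

lemma conj_transpose_mult_vec: "conj_transpose M *v x = conj_vec (transpose M *v conj_vec x)"
  by (simp add: vec_eq_iff conj_transpose_def matrix_vector_mult_def transpose_def)

definition symplectic_complement :: "(complex^'n) set \<Rightarrow> (complex^'n) set"
  where "symplectic_complement R = {y. \<forall>x\<in>R. Im (cinner y x) = 0}"

definition isotropic :: "(complex^'n) set \<Rightarrow> bool"
  where "isotropic R \<longleftrightarrow> R \<subseteq> symplectic_complement R"

definition lagrangian :: "(complex^'n) set \<Rightarrow> bool"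
  where "lagrangian R \<longleftrightarrow> R = symplectic_complement R"

lemma subspace_symplectic_complement: "subspace (symplectic_complement R)"
  by (auto simp: symplectic_complement_def subspace_def cdot_simps scaleR_eq_of_real_smult)

lemma subspace_lagrangian: "lagrangian R \<Longrightarrow> subspace R"
  unfolding lagrangian_def by (metis subspace_symplectic_complement)

lemma subset_symplectic_complement_commute:
  "A \<subseteq> symplectic_complement B \<longleftrightarrow> B \<subseteq> symplectic_complement A"
proof -
  have "Im (cinner x y) = 0 \<longleftrightarrow> Im (cinner y x) = 0" for x y :: "complex^'a"
    by (simp add: cinner_commute[of x y])
  thus ?thesis unfolding symplectic_complement_def by blast
qed

lemma isotropic_span:
  assumes "isotropic B" shows "isotropic (span B)"
proof -
  have "span B \<subseteq> symplectic_complement B"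
    using assms subspace_symplectic_complement unfolding isotropic_def by (rule span_minimal)
  hence "B \<subseteq> symplectic_complement (span B)"
    by (simp only: subset_symplectic_complement_commute)
  thus ?thesis
    using subspace_symplectic_complement unfolding isotropic_def by (rule span_minimal)
qed

lemma isotropic_insert:
  assumes R: "isotropic R" and y: "y \<in> symplectic_complement R"
  shows "isotropic (insert y R)"
proof -
  have "insert y R \<subseteq> symplectic_complement R" using R y by (simp add: isotropic_def)
  hence "R \<subseteq> symplectic_complement (insert y R)"
    by (simp only: subset_symplectic_complement_commute)
  moreover have "y \<in> symplectic_complement (insert y R)"
    using y by (simp add: symplectic_complement_def cinner_self del: of_real_power)
  ultimately show ?thesis by (simp add: isotropic_def)
qed

lemma lagrangian_extension:
  fixes B :: "(complex^'n) set"
  assumes "isotropic B"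
  obtains R where "lagrangian R" "B \<subseteq> R"
proof -
  define P where "P R \<longleftrightarrow> subspace R \<and> isotropic R \<and> B \<subseteq> R" for R :: "(complex^'n) set"
  have "P (span B)"
    by (simp add: P_def isotropic_span assms span_superset)
  moreover have "\<forall>R. P R \<longrightarrow> dim R < Suc (DIM(complex^'n))"
    using dim_subset_UNIV le_imp_less_Suc by blast
  ultimately obtain R where R: "subspace R" "isotropic R" "B \<subseteq> R"
    and maximal: "\<And>R'. P R' \<Longrightarrow> dim R' \<le> dim R"
    using ex_has_greatest_nat[of P "span B" dim "Suc (DIM(complex^'n))"]
    unfolding P_def by blast
  have "y \<in> R" if y: "y \<in> symplectic_complement R" for y
  proof (rule ccontr)
    assume "y \<notin> R"
    have "P (span (insert y R))"
      using R isotropic_span[OF isotropic_insert[OF R(2) y]] span_superset[of "insert y R"]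
      by (auto simp: P_def)
    hence "dim (span (insert y R)) \<le> dim R" by (rule maximal)
    moreover have "dim (insert y R) = dim R + 1"
      using \<open>y \<notin> R\<close> R(1) by (simp add: dim_insert span_eq_iff[THEN iffD2])
    ultimately show False by simp
  qed
  hence "lagrangian R"
    using R(2) unfolding lagrangian_def isotropic_def by blast
  thus thesis using R(3) by (rule that)
qed

lemma lagrangian_decomposition:
  assumes R: "lagrangian R"
  obtains r s where "r \<in> R" "s \<in> R" "x = r + \<i> *s s"
proof -
  let ?iR = "(\<lambda>s. \<i> *s s) ` R"
  have "subspace ?iR"
    using subspace_lagrangian[OF R] by (intro linear_subspace_image)
      (auto simp: linear_iff vec.scale_right_distrib scaleR_eq_of_real_smult)
  hence "span ?iR = ?iR" by (simp add: span_eq_iff)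
  then obtain p r where p: "p \<in> ?iR" and x: "x = p + r"
    and orth: "\<And>w. w \<in> ?iR \<Longrightarrow> orthogonal r w"
    using orthogonal_subspace_decomp_exists[of ?iR x] by metis
  have "Im (cinner r s) = 0" if "s \<in> R" for s
    using orth[of "\<i> *s s"] that by (simp add: orthogonal_def inner_eq_Re_cinner cdot_simps)
  hence "r \<in> R" using R unfolding lagrangian_def symplectic_complement_def by blast
  with p x show thesis using that by (auto simp: add.commute)
qed

lemma lagrangian_orthonormal_basis:
  assumes R: "lagrangian R"
  obtains E where "finite E" "span E = R"
    "\<And>e e'. e \<in> E \<Longrightarrow> e' \<in> E \<Longrightarrow> cinner e e' = of_bool (e = e')"
proof -
  obtain E where E: "E \<subseteq> R" "pairwise orthogonal E" "\<And>x. x \<in> E \<Longrightarrow> norm x = 1"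
    "independent E" "span E = R"
    using orthonormal_basis_subspace[OF subspace_lagrangian[OF R]] by metis
  have "cinner e e' = of_bool (e = e')" if "e \<in> E" "e' \<in> E" for e e'
  proof (rule complex_eqI)
    have "e \<bullet> e' = of_bool (e = e')"
      using that E(2,3) by (auto simp: pairwise_def orthogonal_def norm_eq_1)
    thus "Re (cinner e e') = Re (of_bool (e = e'))" by (simp add: inner_eq_Re_cinner)
    show "Im (cinner e e') = Im (of_bool (e = e'))"
      using R that E(1) unfolding lagrangian_def symplectic_complement_def by auto
  qed
  with E(4,5) independent_imp_finite show thesis using that by blast
qed

lemma lagrangian_imp_symmetric_matrix:
  fixes R :: "(complex^'n) set"
  assumes "lagrangian R"
  obtains U where "transpose U = U" "\<forall>r\<in>R. U *v r = conj_vec r"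
proof -
  obtain E where E: "finite E" "span E = R"
    and orthonormal: "\<And>e e'. e \<in> E \<Longrightarrow> e' \<in> E \<Longrightarrow> cinner e e' = of_bool (e = e')"
    using lagrangian_orthonormal_basis[OF assms] by metis
  define U :: "complex^'n^'n" where "U = (\<chi> i j. \<Sum>e\<in>E. cnj (e $ i) * cnj (e $ j))"
  have mult: "U *v x = (\<Sum>e\<in>E. cinner x e *s conj_vec e)" for x
  proof -
    have "(U *v x) $ i = (\<Sum>e\<in>E. cinner x e *s conj_vec e) $ i" for i
      by (simp add: matrix_vector_mult_def U_def cdot_def sum_distrib_left sum_distrib_right)
         (subst sum.swap, simp add: mult_ac)
    thus ?thesis by (simp add: vec_eq_iff)
  qed
  have "U *v e = conj_vec e" if "e \<in> E" for e
    unfolding mult using that E(1)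
    by (simp add: orthonormal of_bool_def if_distrib[of "\<lambda>c. c *s _"] cong: if_cong)
  moreover have "subspace {x. U *v x = conj_vec x}"
    by (auto simp: subspace_def matrix_vector_right_distrib scaleR_eq_of_real_smult
        vector_scalar_commute)
  ultimately have "U *v r = conj_vec r" if "r \<in> R" for r
    using span_induct[of r E "\<lambda>x. U *v x = conj_vec x"] that E(2) by auto
  moreover have "transpose U = U"
    by (simp add: U_def transpose_def vec_eq_iff mult.commute)
  ultimately show thesis using that by blast
qed

lemma lagrangian_conjugation_imp_unitary:
  assumes R: "lagrangian R" and U: "transpose U = U" "\<forall>r\<in>R. U *v r = conj_vec r"
  shows "unitary_matrix U"
proof -
  have "(conj_transpose U ** U) *v x = mat 1 *v x" for x
  proof -
    obtain r s where "r \<in> R" "s \<in> R" "x = r + \<i> *s s"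
      using lagrangian_decomposition[OF R] .
    thus ?thesis
      by (simp add: matrix_vector_mul_assoc[symmetric] conj_transpose_mult_vec U
          matrix_vector_right_distrib vector_scalar_commute)
  qed
  hence "conj_transpose U ** U = mat 1" by (simp add: matrix_eq)
  thus ?thesis by (simp add: unitary_matrix_def matrix_left_right_inverse)
qed

definition same_gram_on :: "'s set \<Rightarrow> ('s \<Rightarrow> complex^'n) \<Rightarrow> ('s \<Rightarrow> complex^'m) \<Rightarrow> bool"
  where "same_gram_on S a b \<longleftrightarrow> (\<forall>s\<in>S. \<forall>t\<in>S. cinner (a s) (a t) = cinner (b s) (b t))"

text \<open>The two hypotheses say exactly that the vectors \<open>c a(s) + (c b(s))\<^sup>*\<close> span an isotropic
  subspace. On a Lagrangian extension of it \<open>U\<close> is the conjugation, so that \<open>c = 1\<close> and \<open>c = \<i>\<close>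
  together give \<open>U a(s) = b(s)\<close>.\<close>

lemma symmetric_unitary_interpolation:
  fixes a b :: "'s \<Rightarrow> complex^'n"
  assumes gram: "same_gram_on S a b"
    and sym: "\<And>s t. s \<in> S \<Longrightarrow> t \<in> S \<Longrightarrow> cdot (a s) (b t) = cdot (a t) (b s)"
  obtains U where "unitary_matrix U" "transpose U = U" "\<forall>s\<in>S. U *v a s = b s"
proof -
  define v where "v c s = c *s a s + conj_vec (c *s b s)" for c s
  have v_isotropic: "Im (cinner (v c s) (v d t)) = 0" if st: "s \<in> S" "t \<in> S" for c d s t
  proof -
    have "cinner (a s) (a t) = cinner (b s) (b t)"
      using gram st unfolding same_gram_on_def by blast
    hence "cdot (conj_vec (b s)) (b t) = cnj (cinner (a s) (a t))"
      by (simp add: cnj_cdot)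
    moreover have "cdot (conj_vec (b s)) (conj_vec (a t)) = cnj (cdot (a s) (b t))"
      using sym[OF st] by (simp add: cnj_cdot cdot_commute)
    ultimately show ?thesis by (simp add: v_def cdot_simps algebra_simps)
  qed
  have "isotropic {v c s | c s. s \<in> S}"
    unfolding isotropic_def symplectic_complement_def using v_isotropic by blast
  from lagrangian_extension[OF this]
  obtain R where R: "lagrangian R" and vR: "{v c s | c s. s \<in> S} \<subseteq> R" .
  obtain U where U: "transpose U = U" "\<forall>r\<in>R. U *v r = conj_vec r"
    by (rule lagrangian_imp_symmetric_matrix[OF R])
  have "U *v a s = b s" if "s \<in> S" for s
  proof -
    have "v 1 s \<in> R" "v \<i> s \<in> R" using vR that by blast+
    moreover have "a s = (1/2) *s (v 1 s - \<i> *s v \<i> s)"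
      by (simp add: v_def vec_eq_iff algebra_simps)
    ultimately have "U *v a s = (1/2) *s (conj_vec (v 1 s) - \<i> *s conj_vec (v \<i> s))"
      by (simp add: vector_scalar_commute matrix_vector_mult_diff_distrib U(2))
    also have "\<dots> = b s"
      by (simp add: v_def vec_eq_iff algebra_simps)
    finally show ?thesis .
  qed
  with lagrangian_conjugation_imp_unitary[OF R U] U(1) show thesis using that by blast
qed

section \<open>Contractive matrices\<close>

definition contractive_matrix :: "complex^'n^'m \<Rightarrow> bool"
  where "contractive_matrix M \<longleftrightarrow> (\<forall>x. norm (M *v x) \<le> norm x)"

lemma unitary_imp_contractive_matrix: "unitary_matrix U \<Longrightarrow> contractive_matrix U"
  by (simp add: contractive_matrix_def norm_unitary_mult)

lemma contractive_matrix_transpose: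
  assumes "contractive_matrix M" shows "contractive_matrix (transpose M)"
  unfolding contractive_matrix_def
proof
  fix y
  let ?x = "transpose M *v y"
  have "(norm ?x)\<^sup>2 = Re (cinner ?x ?x)"
    by (simp add: cinner_self del: of_real_power)
  also have "\<dots> = y \<bullet> conj_vec (M *v conj_vec ?x)"
    unfolding cdot_transpose inner_eq_Re_cinner by simp
  also have "\<dots> \<le> norm y * norm (M *v conj_vec ?x)"
    using norm_cauchy_schwarz[of y "conj_vec (M *v conj_vec ?x)"] by simp
  also have "\<dots> \<le> norm y * norm ?x"
    using assms norm_conj_vec[of ?x] unfolding contractive_matrix_def
    by (metis mult_left_mono norm_ge_zero)
  finally show "norm ?x \<le> norm y"
    by (cases "?x = 0") (simp_all add: power2_eq_square)
qed

definition join_vec :: "complex^'a \<Rightarrow> complex^'b \<Rightarrow> complex^('a::finite + 'b::finite)"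
  where "join_vec x y = (\<chi> i. case i of Inl a \<Rightarrow> x $ a | Inr b \<Rightarrow> y $ b)"

lemma join_vec_nth [simp]: "join_vec x y $ Inl i = x $ i" "join_vec x y $ Inr j = y $ j"
  by (simp_all add: join_vec_def)

lemma join_vec_eq_iff [simp]: "join_vec x y = join_vec x' y' \<longleftrightarrow> x = x' \<and> y = y'"
  by (auto simp: vec_eq_iff join_vec_def split_sum_all)

lemma conj_vec_join_vec [simp]: "conj_vec (join_vec x y) = join_vec (conj_vec x) (conj_vec y)"
  by (auto simp: vec_eq_iff join_vec_def split: sum.split)

lemma cdot_join_vec [simp]: "cdot (join_vec x y) (join_vec x' y') = cdot x x' + cdot y y'"
  by (simp add: cdot_def sum_UNIV_Plus)

lemma norm_join_vec_0 [simp]: "norm (join_vec x 0) = norm x" "norm (join_vec 0 x) = norm x"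
  by (simp_all add: norm_vec_def L2_set_def sum_UNIV_Plus)

lemma norm_Inr_le: "norm (\<chi> i. v $ Inr i) \<le> norm v" for v :: "complex^('a::finite + 'b::finite)"
  unfolding norm_vec_def L2_set_def sum_UNIV_Plus
  by (intro real_sqrt_le_mono) (simp add: sum_nonneg)

text \<open>The map \<open>(a s, 0) \<mapsto> (0, b s)\<close> on the doubled space satisfies the symmetry condition
  trivially, so that a block of the symmetric unitary matrix obtained for it interpolates.\<close>

lemma contractive_interpolation:
  fixes a b :: "'s \<Rightarrow> complex^'n"
  assumes gram: "same_gram_on S a b"
  obtains T where "contractive_matrix T" "\<forall>s\<in>S. T *v a s = b s"
proof -
  let ?a = "\<lambda>s. join_vec (a s) (0::complex^'n)" and ?b = "\<lambda>s. join_vec (0::complex^'n) (b s)"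
  have doubled_gram: "same_gram_on S ?a ?b"
    using gram by (simp add: same_gram_on_def cdot_simps)
  have doubled_sym: "cdot (?a s) (?b t) = cdot (?a t) (?b s)" for s t
    by (simp add: cdot_simps)
  obtain M where M: "unitary_matrix M" "\<forall>s\<in>S. M *v ?a s = ?b s"
    by (rule symmetric_unitary_interpolation[OF doubled_gram doubled_sym])
  define T :: "complex^'n^'n" where "T = (\<chi> i j. M $ Inr i $ Inl j)"
  have T: "T *v x = (\<chi> i. (M *v join_vec x 0) $ Inr i)" for x
    by (simp add: T_def vec_eq_iff matrix_vector_mult_def sum_UNIV_Plus)
  have "contractive_matrix T"
    unfolding contractive_matrix_def T
    using norm_Inr_le norm_unitary_mult[OF M(1)] by (metis norm_join_vec_0(1))
  moreover have "T *v a s = b s" if "s \<in> S" for s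
    using M(2) that by (simp add: T vec_eq_iff)
  ultimately show thesis using that by blast
qed

section \<open>Polynomials and rational functions\<close>

lemma complex_polynomialI:
  fixes e :: "'k \<Rightarrow> 'n::finite \<Rightarrow> nat"
  assumes "finite K" and p: "\<And>z. p z = (\<Sum>k\<in>K. c k * (\<Prod>i\<in>UNIV. (z $ i) ^ e k i))"
  shows "complex_polynomial p"
proof -
  have "p z = (\<Sum>\<alpha>\<in>e ` K. (\<Sum>k | k \<in> K \<and> e k = \<alpha>. c k) * (\<Prod>i\<in>UNIV. (z $ i) ^ \<alpha> i))" for z
    unfolding p by (subst sum.image_gen[OF assms(1), of _ e]) (simp add: sum_distrib_right)
  hence "\<forall>z. p z = (\<Sum>\<alpha>\<in>e ` K. (\<Sum>k | k \<in> K \<and> e k = \<alpha>. c k) * (\<Prod>i\<in>UNIV. (z $ i) ^ \<alpha> i))"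
    by (rule allI)
  with finite_imageI[OF assms(1), of e] show ?thesis
    unfolding complex_polynomial_def by (intro exI conjI)
qed

lemma complex_polynomialE:
  assumes "complex_polynomial p"
  obtains S c where "finite S" "p = (\<lambda>z. \<Sum>\<alpha>\<in>S. c \<alpha> * (\<Prod>i\<in>UNIV. (z $ i) ^ \<alpha> i))"
  using assms unfolding complex_polynomial_def fun_eq_iff[symmetric]
  by (elim exE conjE) (rule that)

lemma complex_polynomial_const: "complex_polynomial (\<lambda>z. a)"
  by (rule complex_polynomialI[of "{()}" _ "\<lambda>_. a" "\<lambda>_ _. 0"]) auto

lemma complex_polynomial_nth:
  fixes i :: "'n::finite"
  shows "complex_polynomial (\<lambda>z. z $ i)"
proof (rule complex_polynomialI[of "{()}" _ "\<lambda>_. 1" "\<lambda>_ j. if j = i then 1 else 0"])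
  show "z $ i = (\<Sum>k\<in>{()}. 1 * (\<Prod>j\<in>UNIV. z $ j ^ (if j = i then 1 else 0)))" for z :: "complex^'n"
    by (simp add: if_distrib[of "\<lambda>k. _ ^ k"] cong: if_cong)
qed auto

lemma complex_polynomial_add:
  assumes "complex_polynomial p" "complex_polynomial q"
  shows "complex_polynomial (\<lambda>z. p z + q z)"
proof -
  obtain S c where S: "finite S" and p: "p = (\<lambda>z. \<Sum>\<alpha>\<in>S. c \<alpha> * (\<Prod>i\<in>UNIV. (z $ i) ^ \<alpha> i))"
    using assms(1) by (rule complex_polynomialE)
  obtain T d where T: "finite T" and q: "q = (\<lambda>z. \<Sum>\<alpha>\<in>T. d \<alpha> * (\<Prod>i\<in>UNIV. (z $ i) ^ \<alpha> i))"
    using assms(2) by (rule complex_polynomialE)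
  show ?thesis
    unfolding p q using S T
    by (intro complex_polynomialI[of "S <+> T" _ "case_sum c d" "case_sum id id"])
       (auto simp: sum.Plus)
qed

lemma complex_polynomial_mult:
  assumes "complex_polynomial p" "complex_polynomial q"
  shows "complex_polynomial (\<lambda>z. p z * q z)"
proof -
  obtain S c where S: "finite S" and p: "p = (\<lambda>z. \<Sum>\<alpha>\<in>S. c \<alpha> * (\<Prod>i\<in>UNIV. (z $ i) ^ \<alpha> i))"
    using assms(1) by (rule complex_polynomialE)
  obtain T d where T: "finite T" and q: "q = (\<lambda>z. \<Sum>\<alpha>\<in>T. d \<alpha> * (\<Prod>i\<in>UNIV. (z $ i) ^ \<alpha> i))"
    using assms(2) by (rule complex_polynomialE)
  show ?thesis
    unfolding p q using S T
    by (intro complex_polynomialI[of "S \<times> T" _ "\<lambda>(\<alpha>, \<beta>). c \<alpha> * d \<beta>" "\<lambda>(\<alpha>, \<beta>) i. \<alpha> i + \<beta> i"])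
       (auto simp: sum_product sum.cartesian_product power_add prod.distrib algebra_simps
         intro!: sum.cong)
qed

lemma complex_polynomial_sum:
  assumes "\<And>k. k \<in> K \<Longrightarrow> complex_polynomial (p k)"
  shows "complex_polynomial (\<lambda>z. \<Sum>k\<in>K. p k z)"
  using assms
  by (induction K rule: infinite_finite_induct)
     (auto intro: complex_polynomial_const complex_polynomial_add)

lemma complex_polynomial_prod:
  assumes "\<And>k. k \<in> K \<Longrightarrow> complex_polynomial (p k)"
  shows "complex_polynomial (\<lambda>z. \<Prod>k\<in>K. p k z)"
  using assms
  by (induction K rule: infinite_finite_induct)
     (auto intro: complex_polynomial_const complex_polynomial_mult)

lemma complex_polynomial_det:
  fixes M :: "complex^'n \<Rightarrow> complex^'m^'m"
  assumes "\<And>i j. complex_polynomial (\<lambda>z. M z $ i $ j)"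
  shows "complex_polynomial (\<lambda>z. det (M z))"
  unfolding det_def
  by (intro complex_polynomial_sum complex_polynomial_mult complex_polynomial_prod
      complex_polynomial_const assms)

lemma rational_onI:
  assumes "complex_polynomial p" "complex_polynomial q"
    and "\<And>z. z \<in> S \<Longrightarrow> q z \<noteq> 0" "\<And>z. z \<in> S \<Longrightarrow> f z = p z / q z"
  shows "rational_on f S"
  unfolding rational_on_def by (intro exI[of _ p] exI[of _ q]) (simp add: assms)

lemma rational_onE:
  assumes "rational_on f S"
  obtains p q where "complex_polynomial p" "complex_polynomial q"
    "\<forall>z\<in>S. q z \<noteq> 0 \<and> f z = p z / q z"
  using assms unfolding rational_on_def by blast

lemma rational_on_cong: "(\<And>z. z \<in> S \<Longrightarrow> f z = g z) \<Longrightarrow> rational_on f S \<longleftrightarrow> rational_on g S"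
  by (simp add: rational_on_def)

lemma rational_on_subset: "rational_on f S \<Longrightarrow> T \<subseteq> S \<Longrightarrow> rational_on f T"
  unfolding rational_on_def by blast

lemma rational_on_polynomial:
  assumes "complex_polynomial p" shows "rational_on p S"
  by (rule rational_onI[OF assms complex_polynomial_const[of 1]]) auto

lemma rational_on_add:
  assumes "rational_on f S" "rational_on g S"
  shows "rational_on (\<lambda>z. f z + g z) S"
proof -
  obtain p q where f: "complex_polynomial p" "complex_polynomial q"
    "\<forall>z\<in>S. q z \<noteq> 0 \<and> f z = p z / q z"
    using assms(1) by (rule rational_onE)
  obtain p' q' where g: "complex_polynomial p'" "complex_polynomial q'"
    "\<forall>z\<in>S. q' z \<noteq> 0 \<and> g z = p' z / q' z"
    using assms(2) by (rule rational_onE)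
  show ?thesis
  proof (rule rational_onI)
    show "complex_polynomial (\<lambda>z. p z * q' z + p' z * q z)" "complex_polynomial (\<lambda>z. q z * q' z)"
      by (intro complex_polynomial_add complex_polynomial_mult f(1,2) g(1,2))+
  qed (simp_all add: f g add_frac_eq)
qed

lemma rational_on_mult:
  assumes "rational_on f S" "rational_on g S"
  shows "rational_on (\<lambda>z. f z * g z) S"
proof -
  obtain p q where f: "complex_polynomial p" "complex_polynomial q"
    "\<forall>z\<in>S. q z \<noteq> 0 \<and> f z = p z / q z"
    using assms(1) by (rule rational_onE)
  obtain p' q' where g: "complex_polynomial p'" "complex_polynomial q'"
    "\<forall>z\<in>S. q' z \<noteq> 0 \<and> g z = p' z / q' z"
    using assms(2) by (rule rational_onE)
  show ?thesis
  proof (rule rational_onI)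
    show "complex_polynomial (\<lambda>z. p z * p' z)" "complex_polynomial (\<lambda>z. q z * q' z)"
      by (intro complex_polynomial_mult f(1,2) g(1,2))+
  qed (simp_all add: f g)
qed

lemma rational_on_sum:
  assumes "\<And>k. k \<in> K \<Longrightarrow> rational_on (f k) S"
  shows "rational_on (\<lambda>z. \<Sum>k\<in>K. f k z) S"
  using assms
  by (induction K rule: infinite_finite_induct)
     (auto intro: rational_on_polynomial complex_polynomial_const rational_on_add)

section \<open>Colligations\<close>

lemma diag_matrix_mult_vec [simp]: "(diag_matrix z *v x) $ i = z $ i * x $ i"
  by (simp add: matrix_vector_mult_def diag_matrix_def if_distrib if_distribR cong: if_cong)

lemma norm_diag_matrix_mult_less:
  assumes z: "z \<in> polydisk" and x: "x \<noteq> 0"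
  shows "norm (diag_matrix z *v x) < norm x"
proof -
  obtain k where k: "x $ k \<noteq> 0" using x by (auto simp: vec_eq_iff)
  have zi: "cmod (z $ i) < 1" for i using z by (simp add: polydisk_def)
  show ?thesis
    unfolding norm_vec_def L2_set_def diag_matrix_mult_vec
  proof (intro real_sqrt_less_mono sum_strict_mono_ex1 ballI bexI[of _ k])
    show "(norm (z $ i * x $ i))\<^sup>2 \<le> (norm (x $ i))\<^sup>2" for i
      using zi[of i] by (intro power_mono) (auto simp: norm_mult intro: mult_left_le_one_le)
    show "(norm (z $ k * x $ k))\<^sup>2 < (norm (x $ k))\<^sup>2"
      using zi[of k] k by (intro power_strict_mono) (auto simp: norm_mult)
  qed auto
qed

definition resolvent_set :: "complex^'n^'n \<Rightarrow> (complex^'n) set"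
  where "resolvent_set D = {z. invertible (mat 1 - D ** diag_matrix z)}"

lemma polydisk_subset_resolvent_set:
  fixes D :: "complex^'n^'n"
  assumes D: "contractive_matrix D"
  shows "polydisk \<subseteq> resolvent_set D"
proof
  fix z :: "complex^'n" assume z: "z \<in> polydisk"
  have "x = 0" if "(mat 1 - D ** diag_matrix z) *v x = 0" for x
  proof (rule ccontr)
    assume "x \<noteq> 0"
    have "x = D *v (diag_matrix z *v x)"
      using that by (simp add: matrix_vector_mult_diff_rdistrib matrix_vector_mul_assoc)
    hence "norm x \<le> norm (diag_matrix z *v x)"
      using D unfolding contractive_matrix_def by metis
    thus False using norm_diag_matrix_mult_less[OF z \<open>x \<noteq> 0\<close>] by simp
  qed
  thus "z \<in> resolvent_set D"
    by (simp add: resolvent_set_def invertible_left_inverse matrix_left_invertible_ker)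
qed

lemma block_matrix_cases:
  obtains A B C D where "U = block_matrix A B C D"
proof -
  have "U = block_matrix (\<chi> i j. U $ Inl i $ Inl j) (\<chi> i j. U $ Inl i $ Inr j)
     (\<chi> i j. U $ Inr i $ Inl j) (\<chi> i j. U $ Inr i $ Inr j)"
    by (simp add: block_matrix_def vec_eq_iff split: sum.split)
  thus thesis using that by blast
qed

lemma block_matrix_mult_join_vec:
  "block_matrix A B C D *v join_vec x y = join_vec (A *v x + B *v y) (C *v x + D *v y)"
  by (simp add: vec_eq_iff split_sum_all join_vec_def block_matrix_def matrix_vector_mult_def
      sum_UNIV_Plus split: sum.split)

lemma contractive_block_matrix:
  fixes D :: "complex^'n^'n"
  assumes "contractive_matrix (block_matrix A B C D)" shows "contractive_matrix D"
  unfolding contractive_matrix_def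
proof
  fix y :: "complex^'n"
  let ?v = "join_vec (0 :: complex^1) y"
  have "D *v y = (\<chi> i. (block_matrix A B C D *v ?v) $ Inr i)"
    by (simp add: block_matrix_mult_join_vec vec_eq_iff)
  also have "norm \<dots> \<le> norm (block_matrix A B C D *v ?v)" by (rule norm_Inr_le)
  also have "\<dots> \<le> norm ?v" using assms unfolding contractive_matrix_def ..
  finally show "norm (D *v y) \<le> norm y" by simp
qed

lemma polydisk_subset_resolvent_set_unitary:
  "unitary_matrix (block_matrix A B C D) \<Longrightarrow> polydisk \<subseteq> resolvent_set D"
  using polydisk_subset_resolvent_set contractive_block_matrix unitary_imp_contractive_matrix by blast

definition transfer_function ::
    "complex^1^1 \<Rightarrow> complex^'n^1 \<Rightarrow> complex^1^'n \<Rightarrow> complex^'n^'n \<Rightarrow> complex^'n \<Rightarrow> complex"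
  where "transfer_function A B C D z =
    (A + B ** diag_matrix z ** matrix_inv (mat 1 - D ** diag_matrix z) ** C) $ 1 $ 1"

definition colligation_state :: "complex^1^'n \<Rightarrow> complex^'n^'n \<Rightarrow> complex^'n \<Rightarrow> complex^'n"
  where "colligation_state C D z = matrix_inv (mat 1 - D ** diag_matrix z) *v column 1 C"

text \<open>The two sides of the colligation equation \<open>U (1, E\<^sub>z h) = (c, h)\<close>, from which the
  realization formula arises by eliminating the state \<open>h\<close>.\<close>

definition colligation_in :: "complex^'n \<Rightarrow> complex^'n \<Rightarrow> complex^(1 + 'n)"
  where "colligation_in z h = join_vec (vec 1) (diag_matrix z *v h)"

definition colligation_out :: "complex \<Rightarrow> complex^'n \<Rightarrow> complex^(1 + 'n)"
  where "colligation_out c h = join_vec (vec c) h"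

lemma transfer_function_eq:
  fixes D :: "complex^'n^'n"
  shows "transfer_function A B C D z =
    A $ 1 $ 1 + cdot (B $ 1) (diag_matrix z *v colligation_state C D z)"
proof -
  have "(P ** C) $ 1 $ 1 = (P *v column 1 C) $ 1" for P :: "complex^'n^1"
    by (simp add: matrix_matrix_mult_def matrix_vector_mult_def column_def)
  moreover have "(B *v x) $ 1 = cdot (B $ 1) x" for x
    by (simp add: matrix_vector_mult_def cdot_def)
  ultimately show ?thesis
    by (simp add: transfer_function_def colligation_state_def matrix_vector_mul_assoc[symmetric])
qed

lemma colligation_state_iff:
  assumes "z \<in> resolvent_set D"
  shows "(mat 1 - D ** diag_matrix z) *v h = column 1 C \<longleftrightarrow> h = colligation_state C D z"
proof -
  let ?M = "mat 1 - D ** diag_matrix z"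
  have "?M ** matrix_inv ?M = mat 1 \<and> matrix_inv ?M ** ?M = mat 1"
    using assms unfolding resolvent_set_def invertible_def matrix_inv_def mem_Collect_eq
    by (rule someI_ex)
  hence "?M *v (matrix_inv ?M *v x) = x" "matrix_inv ?M *v (?M *v x) = x" for x
    by (simp_all only: matrix_vector_mul_assoc matrix_vector_mul_lid)
  thus ?thesis unfolding colligation_state_def by metis
qed

lemma colligation_iff_transfer_function:
  assumes "z \<in> resolvent_set D"
  shows "block_matrix A B C D *v colligation_in z h = colligation_out c h \<longleftrightarrow>
    c = transfer_function A B C D z \<and> h = colligation_state C D z"
proof -
  have output_eq: "A *v vec 1 + B *v x = vec c \<longleftrightarrow> c = A $ 1 $ 1 + cdot (B $ 1) x" for x
    by (auto simp: vec_eq_iff matrix_vector_mult_def cdot_def)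
  have source_eq: "C *v vec 1 = column 1 C"
    by (simp add: vec_eq_iff matrix_vector_mult_def column_def)
  have state_eq: "column 1 C + D *v (diag_matrix z *v h) = h \<longleftrightarrow>
      (mat 1 - D ** diag_matrix z) *v h = column 1 C"
    by (auto simp: matrix_vector_mult_diff_rdistrib matrix_vector_mul_assoc algebra_simps)
  show ?thesis
    unfolding colligation_in_def colligation_out_def block_matrix_mult_join_vec join_vec_eq_iff
      output_eq source_eq state_eq colligation_state_iff[OF assms] transfer_function_eq by blast
qed

lemma cinner_colligation_in:
  "cinner (colligation_in z h) (colligation_in w k) =
     1 + (\<Sum>i\<in>UNIV. z $ i * cnj (w $ i) * (h $ i * cnj (k $ i)))"
  by (simp add: colligation_in_def) (simp add: cdot_def mult_ac)

lemma cinner_colligation_out: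
  "cinner (colligation_out c h) (colligation_out d k) =
     c * cnj d + (\<Sum>i\<in>UNIV. h $ i * cnj (k $ i))"
  by (simp add: colligation_out_def) (simp add: cdot_def)

lemma cdot_colligation_in_out:
  "cdot (colligation_in z h) (colligation_out d k) = d + (\<Sum>i\<in>UNIV. z $ i * h $ i * k $ i)"
  by (simp add: colligation_in_def colligation_out_def) (simp add: cdot_def)

lemma cdot_colligation_symmetric_iff:
  "cdot (colligation_in z h) (colligation_out d g) =
     cdot (colligation_in w g) (colligation_out c h) \<longleftrightarrow>
     c - d = (\<Sum>i\<in>UNIV. g $ i * (z $ i - w $ i) * h $ i)"
proof -
  have "(\<Sum>i\<in>UNIV. g $ i * (z $ i - w $ i) * h $ i) =
      (\<Sum>i\<in>UNIV. z $ i * h $ i * g $ i) - (\<Sum>i\<in>UNIV. w $ i * g $ i * h $ i)"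
    unfolding sum_subtractf[symmetric] by (simp add: algebra_simps)
  moreover have "d + a = c + b \<longleftrightarrow> c - d = a - b" for a b
    by (rule iffI; algebra)
  ultimately show ?thesis unfolding cdot_colligation_in_out by simp
qed

lemma colligation_difference:
  assumes "U *v colligation_in z h = colligation_out c h"
    and "transpose U *v colligation_in w g = colligation_out d g"
  shows "c - d = (\<Sum>i\<in>UNIV. g $ i * (z $ i - w $ i) * h $ i)"
  using cdot_transpose[of U "colligation_in w g" "colligation_in z h"]
  unfolding assms cdot_colligation_symmetric_iff[symmetric] by (simp only: cdot_commute)

lemma cinner_colligation_self_iff:
  "cinner (colligation_in z h) (colligation_in z h) =
     cinner (colligation_out c h) (colligation_out c h) \<longleftrightarrow>
     (\<Sum>i\<in>UNIV. (1 - (cmod (z $ i))\<^sup>2) * (cmod (h $ i))\<^sup>2) = 1 - (cmod c)\<^sup>2"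
    (is "?in = ?out \<longleftrightarrow> ?sum = ?rhs")
proof -
  have diff: "?out - ?in = complex_of_real (?sum - ?rhs)"
    unfolding cinner_colligation_in cinner_colligation_out
    by (simp add: complex_norm_square algebra_simps sum_subtractf del: of_real_power)
  have "?in = ?out \<longleftrightarrow> ?out - ?in = 0" by auto
  also have "\<dots> \<longleftrightarrow> ?sum = ?rhs"
    unfolding diff of_real_eq_0_iff right_minus_eq ..
  finally show ?thesis .
qed

lemma unitary_colligation_norm:
  assumes "unitary_matrix U" "U *v colligation_in z h = colligation_out c h"
  shows "(\<Sum>i\<in>UNIV. (1 - (cmod (z $ i))\<^sup>2) * (cmod (h $ i))\<^sup>2) = 1 - (cmod c)\<^sup>2"
  using norm_unitary_mult[OF assms(1), of "colligation_in z h"]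
  unfolding assms(2) cinner_colligation_self_iff[symmetric] cinner_self by simp

definition resolvent_denominator :: "complex^'n^'n \<Rightarrow> complex^'n \<Rightarrow> complex"
  where "resolvent_denominator D z = det (mat 1 - D ** diag_matrix z)"

lemma resolvent_set_eq: "resolvent_set D = {z. resolvent_denominator D z \<noteq> 0}"
  by (simp add: resolvent_set_def resolvent_denominator_def invertible_det_nz)

lemma resolvent_nth:
  "(mat 1 - D ** diag_matrix z) $ i $ j = (if i = j then 1 else 0) + - D $ i $ j * z $ j"
  by (simp add: mat_def matrix_matrix_mult_def diag_matrix_def if_distrib cong: if_cong)

lemma resolvent_denominator_0: "resolvent_denominator D 0 = 1"
proof -
  have "mat 1 - D ** diag_matrix 0 = mat 1"
    unfolding vec_eq_iff resolvent_nth by (simp add: mat_def)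
  thus ?thesis by (simp add: resolvent_denominator_def)
qed

lemma complex_polynomial_resolvent_nth:
  "complex_polynomial (\<lambda>z. (mat 1 - D ** diag_matrix z) $ i $ j)"
  unfolding resolvent_nth
  by (intro complex_polynomial_add complex_polynomial_mult complex_polynomial_const
      complex_polynomial_nth)

lemma complex_polynomial_resolvent_denominator: "complex_polynomial (resolvent_denominator D)"
  unfolding resolvent_denominator_def
  by (intro complex_polynomial_det complex_polynomial_resolvent_nth)

lemma rational_on_colligation_state:
  "rational_on (\<lambda>z. colligation_state C D z $ k) (resolvent_set D)"
proof (rule rational_onI)
  let ?M = "\<lambda>z. mat 1 - D ** diag_matrix z"
  let ?p = "\<lambda>z. det (\<chi> i j. if j = k then column 1 C $ i else ?M z $ i $ j)"
  have "complex_polynomial (\<lambda>z. if j = k then column 1 C $ i else ?M z $ i $ j)" for i j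
    by (cases "j = k") (simp_all only: simp_thms if_True if_False complex_polynomial_const
        complex_polynomial_resolvent_nth)
  thus "complex_polynomial ?p" by (intro complex_polynomial_det) simp
  fix z assume z: "z \<in> resolvent_set D"
  thus "resolvent_denominator D z \<noteq> 0" by (simp add: resolvent_set_eq)
  hence "det (?M z) \<noteq> 0" by (simp add: resolvent_denominator_def)
  moreover have "?M z *v colligation_state C D z = column 1 C"
    using colligation_state_iff[OF z] by blast
  ultimately have "colligation_state C D z =
      (\<chi> k. det (\<chi> i j. if j = k then column 1 C $ i else ?M z $ i $ j) / det (?M z))"
    using cramer by blast
  thus "colligation_state C D z $ k = ?p z / resolvent_denominator D z"
    by (simp add: resolvent_denominator_def)
qed (rule complex_polynomial_resolvent_denominator)

lemma rational_on_transfer_function: "rational_on (transfer_function A B C D) (resolvent_set D)"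
  unfolding transfer_function_eq[abs_def] cdot_def diag_matrix_mult_vec
  by (intro rational_on_add rational_on_mult rational_on_sum rational_on_colligation_state
      rational_on_polynomial complex_polynomial_const complex_polynomial_nth)

section \<open>Holomorphy along complex lines\<close>

lemma bounded_linear_smult: "bounded_linear (\<lambda>t. t *s y)" for y :: "complex^'n"
  by (auto simp: linear_conv_bounded_linear[symmetric] linear_iff vec.scale_left_distrib
      scaleR_eq_of_real_smult scaleR_conv_of_real)

lemma continuous_on_line: "continuous_on A (\<lambda>t. x + t *s y)" for x y :: "complex^'n"
  by (intro continuous_intros bounded_linear.continuous_on[OF bounded_linear_smult])

lemma open_line:
  fixes x y :: "complex^'n"
  assumes "open S" shows "open {t. x + t *s y \<in> S}"
  using open_vimage[OF assms continuous_on_line] by (simp add: vimage_def)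

lemma convex_line:
  fixes x y :: "complex^'n"
  assumes "convex S" shows "convex {t. x + t *s y \<in> S}"
proof -
  have "t *s y \<in> (+) (- x) ` S \<longleftrightarrow> x + t *s y \<in> S" for t
    by (auto intro!: image_eqI[of _ _ "x + t *s y"])
  hence "{t. x + t *s y \<in> S} = (\<lambda>t. t *s y) -` ((+) (- x) ` S)" by auto
  also have "convex \<dots>"
    by (intro convex_linear_vimage bounded_linear.linear bounded_linear_smult convex_translation assms)
  finally show ?thesis .
qed

definition line_holomorphic_on :: "(complex^'n \<Rightarrow> complex) \<Rightarrow> (complex^'n) set \<Rightarrow> bool"
    (infixl \<open>(line'_holomorphic'_on)\<close> 50)
  where "f line_holomorphic_on S \<longleftrightarrow>
    continuous_on S f \<and> (\<forall>x y. (\<lambda>t. f (x + t *s y)) holomorphic_on {t. x + t *s y \<in> S})"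

lemma line_holomorphic_onI:
  assumes "continuous_on S f"
    and "\<And>x y. (\<lambda>t. f (x + t *s y)) holomorphic_on {t. x + t *s y \<in> S}"
  shows "f line_holomorphic_on S"
  unfolding line_holomorphic_on_def using assms by blast

lemma line_holomorphic_on_imp_continuous_on: "f line_holomorphic_on S \<Longrightarrow> continuous_on S f"
  by (simp add: line_holomorphic_on_def)

lemma line_holomorphic_onD:
  assumes "f line_holomorphic_on S" "\<And>t. t \<in> T \<Longrightarrow> x + t *s y \<in> S"
  shows "(\<lambda>t. f (x + t *s y)) holomorphic_on T"
proof (rule holomorphic_on_subset)
  show "(\<lambda>t. f (x + t *s y)) holomorphic_on {t. x + t *s y \<in> S}"
    using assms(1) by (simp add: line_holomorphic_on_def)
qed (use assms(2) in blast)

lemma line_holomorphic_on_subset: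
  assumes "f line_holomorphic_on S" "T \<subseteq> S" shows "f line_holomorphic_on T"
  using assms
  by (intro line_holomorphic_onI line_holomorphic_onD[OF assms(1)])
     (auto intro: continuous_on_subset line_holomorphic_on_imp_continuous_on)

lemma line_holomorphic_onI_ball:
  assumes "continuous_on S f"
    and ball: "\<And>x y t. x + t *s y \<in> S \<Longrightarrow>
      \<exists>r>0. (\<lambda>t. f (x + t *s y)) holomorphic_on ball t r"
  shows "f line_holomorphic_on S"
proof (rule line_holomorphic_onI)
  fix x y
  have "(\<lambda>t. f (x + t *s y)) analytic_on {t. x + t *s y \<in> S}"
    unfolding analytic_on_def using ball by blast
  thus "(\<lambda>t. f (x + t *s y)) holomorphic_on {t. x + t *s y \<in> S}"
    by (rule analytic_imp_holomorphic)
qed fact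

lemma line_holomorphic_on_local:
  assumes local: "\<And>z. z \<in> S \<Longrightarrow> \<exists>T. open T \<and> z \<in> T \<and> f line_holomorphic_on T"
  shows "f line_holomorphic_on S"
proof (rule line_holomorphic_onI_ball)
  have "isCont f z" if "z \<in> S" for z
    using local[OF that] line_holomorphic_on_imp_continuous_on continuous_on_interior
    by (metis interior_open)
  thus "continuous_on S f" by (simp add: continuous_at_imp_continuous_on)
  fix x y t assume "x + t *s y \<in> S"
  then obtain T where T: "open T" "x + t *s y \<in> T" "f line_holomorphic_on T"
    using local by blast
  then obtain r where "r > 0" "ball t r \<subseteq> {t. x + t *s y \<in> T}"
    using open_line[OF T(1)] by (metis open_contains_ball mem_Collect_eq)
  thus "\<exists>r>0. (\<lambda>t. f (x + t *s y)) holomorphic_on ball t r"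
    using line_holomorphic_onD[OF T(3)] by blast
qed

lemma line_holomorphic_on_uniform_limit:
  assumes S: "open S" and F: "F \<noteq> bot"
    and hol: "\<forall>\<^sub>F n in F. f n line_holomorphic_on S" and lim: "uniform_limit S f g F"
  shows "g line_holomorphic_on S"
proof (rule line_holomorphic_onI_ball)
  show "continuous_on S g"
    using eventually_mono[OF hol line_holomorphic_on_imp_continuous_on] lim F
    by (rule uniform_limit_theorem)
  fix x y t assume "x + t *s y \<in> S"
  then obtain r where r: "r > 0" and sub: "cball t r \<subseteq> {t. x + t *s y \<in> S}"
    using open_line[OF S] by (metis open_contains_cball mem_Collect_eq)
  have "\<forall>\<^sub>F n in F. (\<lambda>t. f n (x + t *s y)) holomorphic_on cball t r"
    by (rule eventually_mono[OF hol], rule line_holomorphic_onD) (use sub in auto)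
  hence "\<forall>\<^sub>F n in F. continuous_on (cball t r) (\<lambda>t. f n (x + t *s y)) \<and>
      (\<lambda>t. f n (x + t *s y)) holomorphic_on ball t r"
    by (rule eventually_mono)
       (auto intro: holomorphic_on_imp_continuous_on holomorphic_on_subset)
  moreover have "uniform_limit (cball t r) (\<lambda>n t. f n (x + t *s y)) (\<lambda>t. g (x + t *s y)) F"
    by (rule uniform_limit_compose'[OF lim]) (use sub in auto)
  ultimately have "(\<lambda>t. g (x + t *s y)) holomorphic_on ball t r"
    using F by (rule holomorphic_uniform_limit)
  with r show "\<exists>r>0. (\<lambda>t. g (x + t *s y)) holomorphic_on ball t r" by blast
qed

lemma line_holomorphic_on_const: "(\<lambda>_. c) line_holomorphic_on S"
  by (simp add: line_holomorphic_on_def)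

lemma line_holomorphic_on_diff:
  "f line_holomorphic_on S \<Longrightarrow> g line_holomorphic_on S \<Longrightarrow> (\<lambda>z. f z - g z) line_holomorphic_on S"
  by (auto simp: line_holomorphic_on_def intro!: continuous_intros holomorphic_intros)

lemma line_holomorphic_on_divide:
  assumes "f line_holomorphic_on S" "g line_holomorphic_on S" "\<And>z. z \<in> S \<Longrightarrow> g z \<noteq> 0"
  shows "(\<lambda>z. f z / g z) line_holomorphic_on S"
  using assms by (auto simp: line_holomorphic_on_def intro!: continuous_intros holomorphic_intros)

lemma line_holomorphic_on_translate:
  assumes "f line_holomorphic_on S" "\<And>z. z \<in> T \<Longrightarrow> z + a \<in> S"
  shows "(\<lambda>z. f (z + a)) line_holomorphic_on T"
proof (rule line_holomorphic_onI)
  show "continuous_on T (\<lambda>z. f (z + a))"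
    using assms by (intro continuous_on_compose2[OF line_holomorphic_on_imp_continuous_on]
        continuous_intros) auto
  fix x y
  have "x + a + t *s y \<in> S" if "x + t *s y \<in> T" for t
    using assms(2)[OF that] by (simp add: add_ac)
  hence "(\<lambda>t. f (x + a + t *s y)) holomorphic_on {t. x + t *s y \<in> T}"
    by (intro line_holomorphic_onD[OF assms(1)]) simp
  thus "(\<lambda>t. f (x + t *s y + a)) holomorphic_on {t. x + t *s y \<in> T}"
    by (simp add: add_ac)
qed

lemma line_holomorphic_on_compose:
  assumes f: "f line_holomorphic_on S" and g: "g holomorphic_on T" "\<And>z. z \<in> S \<Longrightarrow> f z \<in> T"
  shows "(\<lambda>z. g (f z)) line_holomorphic_on S"
proof (rule line_holomorphic_onI)
  show "continuous_on S (\<lambda>z. g (f z))"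
    using g(2) by (intro continuous_on_compose2[OF holomorphic_on_imp_continuous_on[OF g(1)]
        line_holomorphic_on_imp_continuous_on[OF f]]) auto
  fix x y
  let ?L = "{t. x + t *s y \<in> S}"
  have "(\<lambda>t. f (x + t *s y)) holomorphic_on ?L" by (rule line_holomorphic_onD[OF f]) simp
  moreover have "(\<lambda>t. f (x + t *s y)) ` ?L \<subseteq> T" using g(2) by auto
  ultimately show "(\<lambda>t. g (f (x + t *s y))) holomorphic_on ?L"
    using holomorphic_on_compose_gen[OF _ g(1)] by (simp add: o_def)
qed

lemma line_holomorphic_on_polynomial:
  assumes "complex_polynomial p"
  shows "p line_holomorphic_on S"
proof -
  obtain K c where p: "p = (\<lambda>z. \<Sum>\<alpha>\<in>K. c \<alpha> * (\<Prod>i\<in>UNIV. (z $ i) ^ \<alpha> i))"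
    using assms by (rule complex_polynomialE)
  show ?thesis
    unfolding p by (rule line_holomorphic_onI) (auto intro!: continuous_intros holomorphic_intros)
qed

lemma line_holomorphic_on_rational:
  assumes "rational_on f S" shows "f line_holomorphic_on S"
proof -
  obtain p q where pq: "complex_polynomial p" "complex_polynomial q"
    and f: "\<forall>z\<in>S. q z \<noteq> 0 \<and> f z = p z / q z"
    using assms by (rule rational_onE)
  have "(\<lambda>z. p z / q z) line_holomorphic_on S"
    using f by (intro line_holomorphic_on_divide line_holomorphic_on_polynomial pq) auto
  moreover have "continuous_on S f \<longleftrightarrow> continuous_on S (\<lambda>z. p z / q z)"
    using f by (intro continuous_on_cong) auto
  moreover have "(\<lambda>t. f (x + t *s y)) holomorphic_on {t. x + t *s y \<in> S} \<longleftrightarrow>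
      (\<lambda>t. p (x + t *s y) / q (x + t *s y)) holomorphic_on {t. x + t *s y \<in> S}" for x y
    using f by (intro holomorphic_cong) auto
  ultimately show ?thesis by (simp add: line_holomorphic_on_def)
qed

lemma line_holomorphic_on_cnj_line:
  assumes "f line_holomorphic_on S" "open S" "\<And>t. t \<in> T \<Longrightarrow> m + cnj t *s e \<in> S"
  shows "(\<lambda>t. cnj (f (m + cnj t *s e))) holomorphic_on T"
proof -
  have "cnj \<circ> (\<lambda>t. f (m + t *s e)) \<circ> cnj holomorphic_on cnj ` {t. m + t *s e \<in> S}"
  proof (rule holomorphic_on_compose_cnj_cnj)
    show "open (cnj ` {t. m + t *s e \<in> S})"
      unfolding image_cnj_conv_vimage_cnj
      by (intro open_vimage open_line assms continuous_intros)
    show "(\<lambda>t. f (m + t *s e)) holomorphic_on cnj ` cnj ` {t. m + t *s e \<in> S}"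
      by (rule line_holomorphic_onD[OF assms(1)]) auto
  qed
  moreover have "T \<subseteq> cnj ` {t. m + t *s e \<in> S}"
    using assms(3) by (auto simp: image_cnj_conv_vimage_cnj)
  ultimately show ?thesis
    using holomorphic_on_subset by (fastforce simp: o_def)
qed

lemma line_holomorphic_on_analytic_continuation:
  assumes fg: "f line_holomorphic_on S" "g line_holomorphic_on S" and S: "open S" "convex S"
    and W: "open W" "W \<subseteq> S" "W \<noteq> {}" "\<And>z. z \<in> W \<Longrightarrow> f z = g z" and z: "z \<in> S"
  shows "f z = g z"
proof -
  obtain w where w: "w \<in> W" using W(3) by blast
  let ?l = "\<lambda>t. w + t *s (z - w)"
  have "f (?l 1) = g (?l 1)"
  proof (rule analytic_continuation_open[of "{t. ?l t \<in> W}" "{t. ?l t \<in> S}"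
        "\<lambda>t. f (?l t)" "\<lambda>t. g (?l t)"])
    have "0 \<in> {t. ?l t \<in> W}" using w by simp
    thus "{t. ?l t \<in> W} \<noteq> {}" by blast
    show "connected {t. ?l t \<in> S}" by (intro convex_connected convex_line S)
    show "(\<lambda>t. f (?l t)) holomorphic_on {t. ?l t \<in> S}" "(\<lambda>t. g (?l t)) holomorphic_on {t. ?l t \<in> S}"
      by (intro line_holomorphic_onD[OF fg(1)] line_holomorphic_onD[OF fg(2)], simp)+
    show "open {t. ?l t \<in> W}" "open {t. ?l t \<in> S}" by (intro open_line W S)+
  qed (use W z in auto)
  thus ?thesis by simp
qed

lemma exists_common_nonzero:
  fixes F :: "'i \<Rightarrow> complex^'n \<Rightarrow> complex"
  assumes S: "open S" "convex S" "S \<noteq> {}" and "finite I"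
    and hol: "\<And>i. i \<in> I \<Longrightarrow> F i line_holomorphic_on S"
    and nonzero: "\<And>i. i \<in> I \<Longrightarrow> \<exists>z\<in>S. F i z \<noteq> 0"
  shows "\<exists>z\<in>S. \<forall>i\<in>I. F i z \<noteq> 0"
  using \<open>finite I\<close> hol nonzero
proof (induction I rule: finite_induct)
  case empty
  show ?case using S(3) by auto
next
  case (insert j I)
  define W where "W = (\<Inter>i\<in>I. S \<inter> F i -` (- {0})) \<inter> S"
  have "open W"
    unfolding W_def using insert.hyps(1) insert.prems(1)
    by (intro open_Int open_INT ballI S continuous_open_preimage
        line_holomorphic_on_imp_continuous_on) auto
  moreover have "W \<noteq> {}"
    using insert.IH insert.prems unfolding W_def by blast
  moreover have "W \<subseteq> S" by (auto simp: W_def)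
  ultimately have "\<exists>z\<in>W. F j z \<noteq> 0"
    using line_holomorphic_on_analytic_continuation[OF insert.prems(1)[of j]
        line_holomorphic_on_const[of 0] S(1,2), of W] insert.prems(2)[of j]
    by blast
  thus ?case unfolding W_def by blast
qed

lemma islimpt_open_Int_Reals:
  fixes z :: complex
  assumes "open T" "z \<in> T" "z \<in> \<real>"
  shows "z islimpt (T \<inter> \<real>)"
proof -
  obtain x where z: "z = complex_of_real x" using assms(3) by (rule Reals_cases)
  have "complex_of_real x islimpt complex_of_real ` UNIV"
    by (rule islimpt_isCont_image) (auto simp: islimpt_UNIV eventually_at_filter)
  thus ?thesis
    using assms(1,2) unfolding z
    by (subst Int_commute, intro islimpt_Int_eventually eventually_at_in_open')
      (simp_all add: Reals_def)
qed

text \<open>The lines \<open>t \<mapsto> (m + t e, m + t\<^sup>* e)\<close> lie on the diagonal for real \<open>t\<close> and, for suitable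
  \<open>m\<close> and \<open>e\<close>, pass through a prescribed point \<open>(z, w)\<close> at \<open>t = \<i>\<close>.\<close>

lemma polarization:
  fixes \<Phi> :: "complex^'n \<Rightarrow> complex^'n \<Rightarrow> complex"
  assumes S: "open S" "convex S"
    and hol: "\<And>m e. (\<lambda>t. \<Phi> (m + t *s e) (m + cnj t *s e)) holomorphic_on
        {t. m + t *s e \<in> S \<and> m + cnj t *s e \<in> S}"
    and diag: "\<And>z. z \<in> S \<Longrightarrow> \<Phi> z z = 0" and zw: "z \<in> S" "w \<in> S"
  shows "\<Phi> z w = 0"
proof -
  define m where "m = (1/2) *s (z + w)"
  define e where "e = (- \<i>/2) *s (z - w)"
  define T where "T = {t. m + t *s e \<in> S \<and> m + cnj t *s e \<in> S}"
  have z: "m + \<i> *s e = z" and w: "m + cnj \<i> *s e = w"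
    by (simp_all add: m_def e_def vec_eq_iff field_simps)
  have T_eq: "T = {t. m + t *s e \<in> S} \<inter> cnj -` {t. m + t *s e \<in> S}"
    by (auto simp: T_def)
  have "open T"
    unfolding T_eq by (intro open_Int open_vimage open_line S continuous_intros)
  have "convex T"
    unfolding T_eq by (intro convex_Int convex_linear_vimage convex_line S)
      (auto simp: linear_iff)
  have "\<i> \<in> T" using zw z w by (simp add: T_def)
  have "m \<in> S"
    using convexD[OF S(2) zw, of "1/2" "1/2"]
    by (simp add: m_def vec.scale_right_distrib scaleR_eq_of_real_smult)
  hence "0 \<in> T" by (simp add: T_def)
  have "\<Phi> (m + \<i> *s e) (m + cnj \<i> *s e) = 0"
  proof (rule analytic_continuation[of "\<lambda>t. \<Phi> (m + t *s e) (m + cnj t *s e)" T "T \<inter> \<real>" 0 \<i>])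
    show "(\<lambda>t. \<Phi> (m + t *s e) (m + cnj t *s e)) holomorphic_on T"
      unfolding T_def by (rule hol)
    show "0 islimpt T \<inter> \<real>"
      using \<open>open T\<close> \<open>0 \<in> T\<close> by (rule islimpt_open_Int_Reals) simp
    show "\<Phi> (m + t *s e) (m + cnj t *s e) = 0" if "t \<in> T \<inter> \<real>" for t
      using that by (auto simp: T_def Reals_cnj_iff intro: diag)
  qed (use \<open>open T\<close> \<open>convex T\<close> \<open>0 \<in> T\<close> \<open>\<i> \<in> T\<close> in \<open>auto intro: convex_connected\<close>)
  thus ?thesis unfolding z w .
qed

lemma holomorphic_vec_on_imp_line_holomorphic_on:
  assumes f: "f holomorphic_vec_on S" and S: "open S"
  shows "f line_holomorphic_on S"
proof (rule line_holomorphic_onI)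
  have derivative: "\<exists>F. (f has_derivative F) (at z) \<and> (\<forall>c v. F (c *s v) = c * F v)"
    if "z \<in> S" for z
    using f that at_within_open[OF that S] unfolding holomorphic_vec_on_def by metis
  show "continuous_on S f"
    using derivative has_derivative_continuous by (metis continuous_at_imp_continuous_on)
  fix x y
  have "\<exists>d. ((\<lambda>t. f (x + t *s y)) has_field_derivative d) (at t)"
    if t: "x + t *s y \<in> S" for t
  proof -
    obtain F where F: "(f has_derivative F) (at (x + t *s y))" "\<forall>c v. F (c *s v) = c * F v"
      using derivative[OF t] by blast
    have "((\<lambda>t. x + t *s y) has_derivative (\<lambda>h. h *s y)) (at t)"
      by (auto intro!: derivative_eq_intros bounded_linear_imp_has_derivative bounded_linear_smult)
    from has_derivative_compose[OF this F(1)]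
    have "((\<lambda>t. f (x + t *s y)) has_field_derivative F y) (at t)"
      using F(2) by (simp add: has_field_derivative_def mult_commute_abs)
    thus ?thesis by blast
  qed
  thus "(\<lambda>t. f (x + t *s y)) holomorphic_on {t. x + t *s y \<in> S}"
    using open_line[OF S] by (subst holomorphic_on_open) auto
qed

section \<open>Partial derivatives\<close>

lemma higher_deriv_bound:
  assumes g: "g holomorphic_on ball c r" "\<And>t. t \<in> ball c r \<Longrightarrow> cmod (g t) \<le> M"
    and r: "r > 0" and x: "x \<in> ball c (r/2)"
  shows "cmod ((deriv ^^ n) g x) \<le> fact n * M / (r/4) ^ n"
proof (rule Cauchy_inequality)
  have sub: "cball x (r/4) \<subseteq> ball c r"
    using r x by (simp add: cball_subset_ball_iff dist_commute)
  show "g holomorphic_on ball x (r/4)"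
    using g(1) sub ball_subset_cball holomorphic_on_subset by blast
  show "continuous_on (cball x (r/4)) g"
    using g(1) sub holomorphic_on_imp_continuous_on holomorphic_on_subset by blast
  show "cmod (g t) \<le> M" if "cmod (x - t) = r/4" for t
    using that sub by (intro g(2)) (auto simp: dist_norm)
qed (use r in simp)

lemma difference_quotient_bound:
  assumes g: "g holomorphic_on ball 0 r" "\<And>t. t \<in> ball 0 r \<Longrightarrow> cmod (g t) \<le> M"
    and r: "r > 0" and e: "e \<noteq> 0" "e \<in> ball 0 (r/2)"
  shows "cmod ((g e - g 0) / e - deriv g 0) \<le> 32 * M / r\<^sup>2 * cmod e"
proof -
  have "cmod ((deriv ^^ 0) g e - (\<Sum>i\<le>1. (deriv ^^ i) g 0 * (e - 0) ^ i / fact i))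
      \<le> 32 * M / r\<^sup>2 * cmod (e - 0) ^ Suc 1 / fact 1"
  proof (rule complex_Taylor[of "ball 0 (r/2)" 1 "\<lambda>i. (deriv ^^ i) g"])
    show "((deriv ^^ i) g has_field_derivative (deriv ^^ Suc i) g x) (at x within ball 0 (r/2))"
      if "x \<in> ball 0 (r/2)" for i x
      using that r
      by (intro has_field_derivative_at_within[OF has_field_derivative_higher_deriv[OF g(1)]]) auto
    show "cmod ((deriv ^^ Suc 1) g x) \<le> 32 * M / r\<^sup>2" if "x \<in> ball 0 (r/2)" for x
      using higher_deriv_bound[OF g r that, of "Suc 1"]
      by (simp add: power_divide power2_eq_square)
  qed (use e r in auto)
  hence "cmod (g e - g 0 - deriv g 0 * e) \<le> 32 * M / r\<^sup>2 * cmod e * cmod e"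
    by (simp add: power2_eq_square algebra_simps)
  moreover have "(g e - g 0) / e - deriv g 0 = (g e - g 0 - deriv g 0 * e) / e"
    using e by (simp add: field_simps)
  ultimately show ?thesis
    using e by (simp add: norm_divide divide_le_eq)
qed

lemma partial_deriv_eq_line:
  "partial_deriv i f z = deriv (\<lambda>t. f (z + t *s axis i 1)) 0"
proof -
  have line: "(\<chi> j. if j = i then z $ i + t else z $ j) = z + t *s axis i 1" for t
    by (simp add: vec_eq_iff axis_def)
  show ?thesis
    unfolding partial_deriv_def deriv_shift_0[of _ "z $ i"] comp_def line ..
qed

lemma norm_smult_axis [simp]: "norm (t *s axis i 1) = cmod t"
proof -
  have "(cmod ((t *s axis i 1) $ j))\<^sup>2 = (if j = i then (cmod t)\<^sup>2 else 0)" for j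
    by (simp add: axis_def)
  thus ?thesis unfolding norm_vec_def L2_set_def by simp
qed

lemma ball_perturb:
  fixes z0 z v :: "'a::real_normed_vector"
  assumes "z \<in> ball z0 r" "norm v < s" shows "z + v \<in> ball z0 (r + s)"
proof -
  have "dist z0 (z + v) \<le> dist z0 z + norm v"
    using dist_triangle[of z0 "z + v" z] by (simp add: dist_norm)
  thus ?thesis using assms by simp
qed

lemma partial_deriv_uniform_limit:
  assumes f: "f line_holomorphic_on ball z0 (2 * r)" and r: "r > 0"
    and bound: "\<And>z. z \<in> ball z0 (2 * r) \<Longrightarrow> cmod (f z) \<le> M"
  shows "uniform_limit (ball z0 r)
      (\<lambda>e z. (f (z + e *s axis i 1) - f z) / e) (partial_deriv i f) (at 0)"
proof (rule uniform_limitI)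
  fix \<epsilon> :: real assume "\<epsilon> > 0"
  have "((\<lambda>e. 32 * M / r\<^sup>2 * cmod e) \<longlongrightarrow> 0) (at 0)"
    by (intro tendsto_mult_right_zero tendsto_norm_zero tendsto_ident_at)
  hence small: "\<forall>\<^sub>F e in at 0. 32 * M / r\<^sup>2 * cmod e < \<epsilon>"
    using \<open>\<epsilon> > 0\<close> by (rule order_tendstoD)
  have "\<forall>\<^sub>F e in at 0. e \<in> ball 0 (r/2) \<and> e \<noteq> 0 \<and> e \<in> (UNIV :: complex set)"
    using r by (intro eventually_at_ball') simp
  with small show "\<forall>\<^sub>F e in at 0. \<forall>z\<in>ball z0 r.
      dist ((f (z + e *s axis i 1) - f z) / e) (partial_deriv i f z) < \<epsilon>"
  proof (eventually_elim, intro ballI)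
    fix e and z :: "complex^'a"
    assume e: "32 * M / r\<^sup>2 * cmod e < \<epsilon>" "e \<in> ball 0 (r/2) \<and> e \<noteq> 0 \<and> e \<in> UNIV"
      and z: "z \<in> ball z0 r"
    let ?g = "\<lambda>t. f (z + t *s axis i 1)"
    have inside: "z + t *s axis i 1 \<in> ball z0 (2 * r)" if "t \<in> ball 0 r" for t
      using ball_perturb[OF z, of _ r] that by simp
    have "cmod ((?g e - ?g 0) / e - deriv ?g 0) \<le> 32 * M / r\<^sup>2 * cmod e"
      using e(2) r by (intro difference_quotient_bound line_holomorphic_onD[OF f] bound inside) auto
    with e(1) show "dist ((f (z + e *s axis i 1) - f z) / e) (partial_deriv i f z) < \<epsilon>"
      by (simp add: dist_norm partial_deriv_eq_line)
  qed
qed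

lemma line_holomorphic_on_partial_deriv:
  assumes f: "f line_holomorphic_on S" and S: "open S"
  shows "partial_deriv i f line_holomorphic_on S"
proof (rule line_holomorphic_on_local)
  fix z0 assume "z0 \<in> S"
  define M where "M = cmod (f z0) + 1"
  have "open (S \<inter> (\<lambda>z. cmod (f z)) -` {..<M})"
    by (intro continuous_open_preimage continuous_on_norm line_holomorphic_on_imp_continuous_on f S)
      simp
  moreover have "z0 \<in> S \<inter> (\<lambda>z. cmod (f z)) -` {..<M}"
    using \<open>z0 \<in> S\<close> by (simp add: M_def)
  ultimately obtain R where R: "R > 0" "ball z0 R \<subseteq> S \<inter> (\<lambda>z. cmod (f z)) -` {..<M}"
    by (metis open_contains_ball)
  define r where "r = R / 2"
  have r: "r > 0" and sub: "ball z0 (2 * r) \<subseteq> S"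
    and bound: "\<And>z. z \<in> ball z0 (2 * r) \<Longrightarrow> cmod (f z) \<le> M"
    using R by (auto simp: r_def subset_iff less_imp_le)
  note f' = line_holomorphic_on_subset[OF f sub]
  have "partial_deriv i f line_holomorphic_on ball z0 r"
  proof (rule line_holomorphic_on_uniform_limit)
    show "uniform_limit (ball z0 r)
      (\<lambda>e z. (f (z + e *s axis i 1) - f z) / e) (partial_deriv i f) (at 0)"
      by (rule partial_deriv_uniform_limit[OF f' r bound])
    have "\<forall>\<^sub>F e in at 0. e \<in> ball 0 r \<and> e \<noteq> 0 \<and> e \<in> (UNIV :: complex set)"
      using r by (rule eventually_at_ball')
    thus "\<forall>\<^sub>F e in at 0. (\<lambda>z. (f (z + e *s axis i 1) - f z) / e) line_holomorphic_on ball z0 r"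
    proof eventually_elim
      case (elim e)
      hence "z + e *s axis i 1 \<in> ball z0 (2 * r)" if "z \<in> ball z0 r" for z
        using ball_perturb[OF that, of _ r] by simp
      moreover have "f line_holomorphic_on ball z0 r"
        using r by (intro line_holomorphic_on_subset[OF f']) auto
      ultimately show ?case
        using elim by (intro line_holomorphic_on_divide line_holomorphic_on_diff
            line_holomorphic_on_const line_holomorphic_on_translate[OF f']) auto
    qed
  qed simp_all
  with r show "\<exists>T. open T \<and> z0 \<in> T \<and> partial_deriv i f line_holomorphic_on T"
    by (intro exI[of _ "ball z0 r"]) simp
qed

lemma partial_deriv_of_difference_formula:
  fixes f :: "complex^'n \<Rightarrow> complex" and g :: "complex^'n" and h :: "complex^'n \<Rightarrow> complex^'n"
  assumes S: "open S" "w \<in> S" and cont: "continuous_on S (\<lambda>z. h z $ i)"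
    and diff: "\<And>z. z \<in> S \<Longrightarrow> f z - f w = (\<Sum>k\<in>UNIV. g $ k * (z $ k - w $ k) * h z $ k)"
  shows "partial_deriv i f w = g $ i * h w $ i"
proof -
  let ?l = "\<lambda>t. w + t *s axis i 1"
  let ?T = "{t. ?l t \<in> S}"
  have T: "open ?T" "0 \<in> ?T" using open_line[OF S(1)] S(2) by simp_all
  have "continuous_on ?T (\<lambda>t. h (?l t) $ i)"
    by (intro continuous_on_compose2[OF cont continuous_on_line]) auto
  hence "isCont (\<lambda>t. h (?l t) $ i) 0"
    using T by (simp add: continuous_on_eq_continuous_at)
  hence "((\<lambda>t. g $ i * h (?l t) $ i) \<longlongrightarrow> g $ i * h w $ i) (at 0)"
    using tendsto_mult_left[of "\<lambda>t. h (?l t) $ i"] by (simp add: isCont_def)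
  moreover have "\<forall>\<^sub>F t in at 0. g $ i * h (?l t) $ i = (f (?l t) - f (?l 0)) / (t - 0)"
    using eventually_at_in_open[OF T]
  proof eventually_elim
    case (elim t)
    have "(\<Sum>k\<in>UNIV. g $ k * (?l t $ k - w $ k) * h (?l t) $ k) =
        (\<Sum>k\<in>UNIV. if k = i then g $ i * t * h (?l t) $ i else 0)"
      by (rule sum.cong) (auto simp: axis_def)
    thus ?case using elim diff[of "?l t"] by simp
  qed
  ultimately have "((\<lambda>t. (f (?l t) - f (?l 0)) / (t - 0)) \<longlongrightarrow> g $ i * h w $ i) (at 0)"
    by (rule Lim_transform_eventually)
  hence "((\<lambda>t. f (?l t)) has_field_derivative g $ i * h w $ i) (at 0)"
    by (simp add: has_field_derivative_iff)
  thus ?thesis unfolding partial_deriv_eq_line by (rule DERIV_imp_deriv)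
qed

section \<open>Zero sets on the torus\<close>

lemma null_set_of_null_line_sections:
  fixes N :: "'a::euclidean_space set"
  assumes N[measurable]: "N \<in> sets borel"
    and sections: "\<And>x. {t \<in> {0..1::real}. x + t *\<^sub>R e \<in> N} \<in> null_sets lborel"
  shows "N \<in> null_sets lborel"
proof -
  define G :: "real \<Rightarrow> 'a \<Rightarrow> ennreal"
    where "G t x = indicator N (x + t *\<^sub>R e) * indicator {0..1} t" for t x
  have measurable_G: "case_prod G \<in> borel_measurable (lborel \<Otimes>\<^sub>M lborel)"
    unfolding G_def by measurable
  have translates: "(\<integral>\<^sup>+x. G t x \<partial>lborel) = emeasure lborel N * indicator {0..1} t" for t
  proof -
    have "(\<integral>\<^sup>+x. G t x \<partial>lborel) = (\<integral>\<^sup>+x. indicator N (t *\<^sub>R e + x) \<partial>lborel) * indicator {0..1} t"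
      unfolding G_def by (subst nn_integral_multc) (auto simp: add.commute)
    also have "(\<integral>\<^sup>+x. indicator N (t *\<^sub>R e + x) \<partial>lborel) =
        (\<integral>\<^sup>+x. indicator N x \<partial>distr lborel borel ((+) (t *\<^sub>R e)))"
      by (subst nn_integral_distr) auto
    also have "\<dots> = emeasure lborel N" by (simp add: lborel_distr_plus)
    finally show ?thesis .
  qed
  have lines: "(\<integral>\<^sup>+t. G t x \<partial>lborel) = 0" for x
  proof -
    have "G t x = indicator {t \<in> {0..1}. x + t *\<^sub>R e \<in> N} t" for t
      by (auto simp: G_def indicator_def)
    thus ?thesis using sections[of x] by (simp add: null_sets_def)
  qed
  have "emeasure lborel N = (\<integral>\<^sup>+t. emeasure lborel N * indicator {0..1::real} t \<partial>lborel)"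
    by (subst nn_integral_cmult) auto
  also have "\<dots> = (\<integral>\<^sup>+t. \<integral>\<^sup>+x. G t x \<partial>lborel \<partial>lborel)" by (simp add: translates)
  also have "\<dots> = (\<integral>\<^sup>+x. \<integral>\<^sup>+t. G t x \<partial>lborel \<partial>lborel)"
    by (rule lborel_pair.Fubini'[OF measurable_G, symmetric])
  also have "\<dots> = 0" by (simp add: lines)
  finally show ?thesis by (simp add: null_sets_def)
qed

definition cis_vec :: "real^'n \<Rightarrow> complex^'n"
  where "cis_vec \<theta> = (\<chi> i. cis (\<theta> $ i))"

lemma continuous_on_cis_vec: "continuous_on S cis_vec"
  unfolding cis_vec_def[abs_def] by (intro continuous_intros)

text \<open>Moving \<open>\<theta>\<close> in the direction \<open>(1, \<dots>, 1)\<close> moves \<open>cis_vec \<theta>\<close> in a complex line through \<open>0\<close>, on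
  which \<open>q\<close> does not vanish identically.\<close>

lemma countable_cis_vec_zeros:
  fixes \<theta> :: "real^'n"
  assumes q: "q line_holomorphic_on UNIV" "q 0 \<noteq> 0"
  shows "countable {t \<in> {0..1}. q (cis_vec (\<theta> + t *\<^sub>R (\<chi> i. 1))) = 0}" (is "countable ?T")
proof -
  have "countable {c. q (0 + c *s cis_vec \<theta>) = 0}"
  proof (rule ccontr)
    assume "uncountable {c. q (0 + c *s cis_vec \<theta>) = 0}"
    hence "(\<lambda>c. q (0 + c *s cis_vec \<theta>)) = (\<lambda>_. 0)"
      by (intro holomorphic_countable_equal_UNIV line_holomorphic_onD[OF q(1)]) auto
    from fun_cong[OF this, of 0] q(2) show False by simp
  qed
  moreover have "cis_vec (\<theta> + t *\<^sub>R (\<chi> i. 1)) = cis t *s cis_vec \<theta>" for t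
    by (simp add: cis_vec_def vec_eq_iff cis_mult add.commute)
  hence "cis ` ?T \<subseteq> {c. q (0 + c *s cis_vec \<theta>) = 0}" by auto
  ultimately have "countable (cis ` ?T)" using countable_subset by blast
  moreover have "inj_on cis ?T"
  proof (rule inj_onI)
    fix s t assume st: "s \<in> ?T" "t \<in> ?T" "cis s = cis t"
    hence "sin s = sin t" by (simp add: complex_eq_iff)
    moreover have "- (pi/2) \<le> s" "s \<le> pi/2" "- (pi/2) \<le> t" "t \<le> pi/2"
      using st(1,2) pi_gt3 by auto
    ultimately show "s = t" by (metis sin_inj_pi)
  qed
  ultimately show ?thesis by (rule countable_image_inj_on)
qed

lemma AE_cis_vec_nonzero:
  fixes q :: "complex^'n \<Rightarrow> complex"
  assumes q: "q line_holomorphic_on UNIV" "q 0 \<noteq> 0"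
  shows "AE \<theta> in lborel. q (cis_vec \<theta>) \<noteq> 0"
proof -
  let ?N = "{\<theta>. q (cis_vec \<theta>) = 0}"
  have "closed ?N"
    by (intro closed_Collect_eq continuous_on_const
        continuous_on_compose2[OF line_holomorphic_on_imp_continuous_on[OF q(1)]
          continuous_on_cis_vec]) simp
  moreover have "{t \<in> {0..1}. \<theta> + t *\<^sub>R (\<chi> i. 1) \<in> ?N} \<in> null_sets lborel" for \<theta>
    using countable_imp_null_set_lborel[OF countable_cis_vec_zeros[OF q]] by simp
  ultimately have "?N \<in> null_sets lborel"
    by (rule null_set_of_null_line_sections[OF borel_closed])
  thus ?thesis by (rule AE_I') simp
qed

lemma AE_torus_measure_nonzero:
  fixes q :: "complex^'n \<Rightarrow> complex"
  assumes q: "q line_holomorphic_on UNIV" "q 0 \<noteq> 0"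
  shows "AE \<zeta> in torus_measure. q \<zeta> \<noteq> 0 \<and> (\<forall>i. cmod (\<zeta> $ i) = 1)"
proof -
  let ?M = "restrict_space lborel (cbox 0 (\<chi> i. 2 * pi) :: (real^'n) set)"
  have measurable_cis_vec: "cis_vec \<in> ?M \<rightarrow>\<^sub>M borel"
    by (intro measurable_restrict_space1)
       (simp add: borel_measurable_continuous_onI continuous_on_cis_vec)
  have "open {\<zeta>. q \<zeta> \<noteq> 0}"
    by (intro open_Collect_neq line_holomorphic_on_imp_continuous_on q continuous_on_const)
  moreover have "closed {\<zeta> :: complex^'n. \<forall>i. cmod (\<zeta> $ i) = 1}"
    by (intro closed_Collect_all closed_Collect_eq continuous_intros)
  ultimately have "{\<zeta>. q \<zeta> \<noteq> 0} \<inter> {\<zeta>. \<forall>i. cmod (\<zeta> $ i) = 1} \<in> sets borel"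
    by (intro sets.Int borel_open borel_closed)
  hence borel: "{\<zeta> \<in> space borel. q \<zeta> \<noteq> 0 \<and> (\<forall>i. cmod (\<zeta> $ i) = 1)} \<in> sets borel"
    by (simp add: Collect_conj_eq)
  have "AE \<theta> in ?M. q (cis_vec \<theta>) \<noteq> 0 \<and> (\<forall>i. cmod (cis_vec \<theta> $ i) = 1)"
    using AE_cis_vec_nonzero[OF q] by (subst AE_restrict_space_iff) (auto simp: cis_vec_def)
  thus ?thesis
    unfolding torus_measure_def cis_vec_def[abs_def, symmetric]
      AE_distr_iff[OF measurable_cis_vec borel] .
qed

section \<open>From a realization to the identity\<close>

definition schwarz_pick_equality :: "(complex^'n \<Rightarrow> complex) \<Rightarrow> complex^'n \<Rightarrow> bool"
  where "schwarz_pick_equality f z \<longleftrightarrow>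
    (\<Sum>i\<in>UNIV. (1 - (cmod (z $ i))\<^sup>2) * cmod (partial_deriv i f z)) = 1 - (cmod (f z))\<^sup>2"

lemma polydisk_eq_INT_vimage: "polydisk = (\<Inter>i. (\<lambda>z. z $ i) -` ball 0 1)"
  by (auto simp: polydisk_def)

lemma open_polydisk: "open polydisk"
  unfolding polydisk_eq_INT_vimage
  by (intro open_INT finite ballI open_vimage continuous_intros) auto

lemma convex_polydisk: "convex polydisk"
  unfolding polydisk_eq_INT_vimage
  by (intro convex_INT convex_linear_vimage) (auto simp: linear_iff)

lemma colligation_transfer_function:
  assumes "z \<in> resolvent_set D"
  shows "block_matrix A B C D *v colligation_in z (colligation_state C D z) =
    colligation_out (transfer_function A B C D z) (colligation_state C D z)"
  using colligation_iff_transfer_function[OF assms] by blast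

lemma symmetric_unitary_realization_imp_schwarz_pick_equality:
  fixes D :: "complex^'n^'n"
  assumes U: "unitary_matrix (block_matrix A B C D)"
    and sym: "transpose (block_matrix A B C D) = block_matrix A B C D"
    and f: "\<And>z. z \<in> polydisk \<Longrightarrow> f z = transfer_function A B C D z" and w: "w \<in> polydisk"
  shows "schwarz_pick_equality f w"
proof -
  let ?h = "colligation_state C D"
  note disk = polydisk_subset_resolvent_set_unitary[OF U]
  have colligation: "block_matrix A B C D *v colligation_in z (?h z) = colligation_out (f z) (?h z)"
    if "z \<in> polydisk" for z
    using colligation_transfer_function[of z D] that disk f by auto
  have "partial_deriv i f w = ?h w $ i * ?h w $ i" for i
  proof (rule partial_deriv_of_difference_formula[OF open_polydisk w])
    show "continuous_on polydisk (\<lambda>z. ?h z $ i)"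
      by (intro line_holomorphic_on_imp_continuous_on line_holomorphic_on_rational
          rational_on_subset[OF rational_on_colligation_state disk])
    show "f z - f w = (\<Sum>k\<in>UNIV. ?h w $ k * (z $ k - w $ k) * ?h z $ k)" if "z \<in> polydisk" for z
      using colligation_difference[OF colligation[OF that]] colligation[OF w] sym by simp
  qed
  hence "cmod (partial_deriv i f w) = (cmod (?h w $ i))\<^sup>2" for i
    by (simp add: norm_mult power2_eq_square)
  thus ?thesis
    using unitary_colligation_norm[OF U colligation[OF w]] by (simp add: schwarz_pick_equality_def)
qed

lemma norm_transfer_function_torus:
  fixes D :: "complex^'n^'n"
  assumes U: "unitary_matrix (block_matrix A B C D)"
    and \<zeta>: "\<zeta> \<in> resolvent_set D" "\<And>i. cmod (\<zeta> $ i) = 1"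
  shows "cmod (transfer_function A B C D \<zeta>) = 1"
proof -
  have "(cmod (transfer_function A B C D \<zeta>))\<^sup>2 = 1"
    using unitary_colligation_norm[OF U colligation_transfer_function[OF \<zeta>(1)]] \<zeta>(2) by simp
  thus ?thesis by (simp add: power2_eq_1_iff) (smt (verit) norm_ge_zero)
qed

lemma open_resolvent_set: "open (resolvent_set D)"
  unfolding resolvent_set_eq
  by (intro open_Collect_neq continuous_on_const line_holomorphic_on_imp_continuous_on
      line_holomorphic_on_polynomial complex_polynomial_resolvent_denominator)

lemma rational_on_unitary_realization:
  assumes "unitary_matrix (block_matrix A B C D)"
    and "\<And>z. z \<in> polydisk \<Longrightarrow> f z = transfer_function A B C D z"
  shows "rational_on f polydisk"
  using rational_on_subset[OF rational_on_transfer_function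
      polydisk_subset_resolvent_set_unitary[OF assms(1)]] assms(2)
  by (simp cong: rational_on_cong)

lemma inner_function_unitary_realization:
  fixes D :: "complex^'n^'n"
  assumes U: "unitary_matrix (block_matrix A B C D)"
    and f: "f holomorphic_vec_on polydisk" "bounded (f ` polydisk)"
    and transfer: "\<And>z. z \<in> polydisk \<Longrightarrow> f z = transfer_function A B C D z"
  shows "inner_function f"
proof -
  let ?t = "transfer_function A B C D"
  have "AE \<zeta> in torus_measure. resolvent_denominator D \<zeta> \<noteq> 0 \<and> (\<forall>i. cmod (\<zeta> $ i) = 1)"
    by (rule AE_torus_measure_nonzero)
       (simp_all add: line_holomorphic_on_polynomial complex_polynomial_resolvent_denominator
         resolvent_denominator_0)
  hence "AE \<zeta> in torus_measure. \<exists>L. ((\<lambda>r::real. f (r *\<^sub>R \<zeta>)) \<longlongrightarrow> L) (at_left 1) \<and> cmod L = 1"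
  proof eventually_elim
    case (elim \<zeta>)
    hence \<zeta>: "\<zeta> \<in> resolvent_set D" "\<And>i. cmod (\<zeta> $ i) = 1" by (simp_all add: resolvent_set_eq)
    have "continuous_on (resolvent_set D) ?t"
      by (intro line_holomorphic_on_imp_continuous_on line_holomorphic_on_rational
          rational_on_transfer_function)
    hence "isCont ?t \<zeta>"
      using open_resolvent_set[of D] \<zeta>(1) by (simp add: continuous_on_eq_continuous_at)
    moreover have "((\<lambda>r::real. r *\<^sub>R \<zeta>) \<longlongrightarrow> 1 *\<^sub>R \<zeta>) (at_left 1)"
      by (intro tendsto_intros)
    ultimately have "((\<lambda>r::real. ?t (r *\<^sub>R \<zeta>)) \<longlongrightarrow> ?t \<zeta>) (at_left 1)"
      by (intro isCont_tendsto_compose[of \<zeta> ?t]) simp_all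
    moreover have "\<forall>\<^sub>F r in at_left (1::real). ?t (r *\<^sub>R \<zeta>) = f (r *\<^sub>R \<zeta>)"
    proof (rule eventually_at_leftI[of 0])
      fix r :: real assume "r \<in> {0<..<1}"
      hence "r *\<^sub>R \<zeta> \<in> polydisk" using \<zeta>(2) by (simp add: polydisk_def)
      thus "?t (r *\<^sub>R \<zeta>) = f (r *\<^sub>R \<zeta>)" using transfer by simp
    qed simp
    ultimately have "((\<lambda>r::real. f (r *\<^sub>R \<zeta>)) \<longlongrightarrow> ?t \<zeta>) (at_left 1)"
      by (rule Lim_transform_eventually)
    thus ?case
      using norm_transfer_function_torus[OF U \<zeta>] by blast
  qed
  thus ?thesis using f by (simp add: inner_function_def)
qed

section \<open>From the identity to a realization\<close>

lemma holomorphic_on_csqrt_branch: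
  assumes "c \<noteq> 0"
  shows "(\<lambda>w. csqrt c * csqrt (w / c)) holomorphic_on {w. 0 < Re (w / c)}"
  using assms by (intro holomorphic_intros) (auto simp: complex_nonpos_Reals_iff)

lemma local_square_roots:
  fixes F :: "'i::finite \<Rightarrow> complex^'n \<Rightarrow> complex"
  assumes S: "open S" "z0 \<in> S" and hol: "\<And>i. F i line_holomorphic_on S"
    and nonzero: "\<And>i. F i z0 \<noteq> 0"
  obtains r h where "r > 0" "ball z0 r \<subseteq> S" "\<forall>i. (\<lambda>z. h z $ i) line_holomorphic_on ball z0 r"
    "\<forall>z\<in>ball z0 r. \<forall>i. h z $ i \<noteq> 0 \<and> h z $ i * h z $ i = F i z"
proof -
  let ?H = "\<lambda>i. {w. 0 < Re (w / F i z0)}"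
  have "open (S \<inter> F i -` ?H i)" for i
    using nonzero by (intro continuous_open_preimage line_holomorphic_on_imp_continuous_on[OF hol] S
        open_Collect_less continuous_intros) auto
  hence "open (\<Inter>i. S \<inter> F i -` ?H i)" by (intro open_INT) auto
  moreover have "z0 \<in> (\<Inter>i. S \<inter> F i -` ?H i)" using S nonzero by simp
  ultimately obtain r where r: "r > 0" "ball z0 r \<subseteq> (\<Inter>i. S \<inter> F i -` ?H i)"
    by (rule openE)
  hence sub: "ball z0 r \<subseteq> S" and half_plane: "\<And>i z. z \<in> ball z0 r \<Longrightarrow> F i z \<in> ?H i"
    by blast+
  define h where "h z = (\<chi> i. csqrt (F i z0) * csqrt (F i z / F i z0))" for z
  have "(\<lambda>z. h z $ i) line_holomorphic_on ball z0 r" for i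
    unfolding h_def vec_lambda_beta
    by (rule line_holomorphic_on_compose[OF line_holomorphic_on_subset[OF hol sub]
          holomorphic_on_csqrt_branch[OF nonzero] half_plane])
  moreover have "h z $ i * h z $ i = F i z" for z i
  proof -
    have "h z $ i * h z $ i = (csqrt (F i z0))\<^sup>2 * (csqrt (F i z / F i z0))\<^sup>2"
      by (simp add: h_def power2_eq_square)
    thus ?thesis using nonzero by simp
  qed
  moreover have "F i z \<noteq> 0" if "z \<in> ball z0 r" for z i
    using half_plane[OF that, of i] by auto
  ultimately show thesis
    using that[OF r(1) sub, of h] by (metis mult_zero_left)
qed

lemma norm_identity_imp_same_gram_on:
  fixes f :: "complex^'n \<Rightarrow> complex" and h :: "complex^'n \<Rightarrow> complex^'n"
  assumes S: "open S" "convex S" and f: "f line_holomorphic_on S"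
    and h: "\<And>i. (\<lambda>z. h z $ i) line_holomorphic_on S"
    and identity: "\<And>z. z \<in> S \<Longrightarrow>
      (\<Sum>i\<in>UNIV. (1 - (cmod (z $ i))\<^sup>2) * (cmod (h z $ i))\<^sup>2) = 1 - (cmod (f z))\<^sup>2"
  shows "same_gram_on S (\<lambda>z. colligation_in z (h z)) (\<lambda>z. colligation_out (f z) (h z))"
  unfolding same_gram_on_def
proof (intro ballI)
  fix z w assume zw: "z \<in> S" "w \<in> S"
  define \<Phi> where "\<Phi> z w = cinner (colligation_in z (h z)) (colligation_in w (h w)) -
      cinner (colligation_out (f z) (h z)) (colligation_out (f w) (h w))" for z w
  have "\<Phi> z w = 0"
  proof (rule polarization[OF S _ _ zw])
    fix m e
    let ?T = "{t. m + t *s e \<in> S \<and> m + cnj t *s e \<in> S}"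
    have line: "(\<lambda>t. g (m + t *s e)) holomorphic_on ?T" if "g line_holomorphic_on S" for g
      using that by (rule line_holomorphic_onD) simp
    have cnj_line: "(\<lambda>t. cnj (g (m + cnj t *s e))) holomorphic_on ?T"
      if "g line_holomorphic_on S" for g
      using that S(1) by (rule line_holomorphic_on_cnj_line) simp
    have coordinate: "(\<lambda>z. z $ i) line_holomorphic_on S" for i
      by (rule line_holomorphic_on_polynomial[OF complex_polynomial_nth])
    show "(\<lambda>t. \<Phi> (m + t *s e) (m + cnj t *s e)) holomorphic_on ?T"
      unfolding \<Phi>_def cinner_colligation_in cinner_colligation_out
      by (intro holomorphic_on_diff holomorphic_on_add holomorphic_on_mult holomorphic_on_sum
          holomorphic_on_const line[OF coordinate] cnj_line[OF coordinate] line[OF f]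
          cnj_line[OF f] line[OF h] cnj_line[OF h])
  next
    show "\<Phi> z z = 0" if "z \<in> S" for z
      using identity[OF that] unfolding \<Phi>_def cinner_colligation_self_iff[symmetric] by simp
  qed
  thus "cinner (colligation_in z (h z)) (colligation_in w (h w)) =
      cinner (colligation_out (f z) (h z)) (colligation_out (f w) (h w))"
    by (simp add: \<Phi>_def)
qed

text \<open>A contractive realization \<open>T\<close> has a transposed state \<open>g\<close> at \<open>w\<close>, with which
  \<open>f(z) - f(w) = \<Sum> g\<^sub>i (z\<^sub>i - w\<^sub>i) h\<^sub>i(z)\<close>. Comparing derivatives at \<open>w\<close> gives
  \<open>g\<^sub>i h\<^sub>i(w) = h\<^sub>i(w)\<^sup>2\<close>.\<close>

lemma difference_formula_of_square_roots:
  fixes f :: "complex^'n \<Rightarrow> complex" and h :: "complex^'n \<Rightarrow> complex^'n"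
  assumes S: "open S" "S \<subseteq> polydisk" and cont: "\<And>i. continuous_on S (\<lambda>z. h z $ i)"
    and roots: "\<And>i z. z \<in> S \<Longrightarrow> h z $ i \<noteq> 0 \<and> h z $ i * h z $ i = partial_deriv i f z"
    and gram: "same_gram_on S (\<lambda>z. colligation_in z (h z)) (\<lambda>z. colligation_out (f z) (h z))"
    and zw: "z \<in> S" "w \<in> S"
  shows "f z - f w = (\<Sum>i\<in>UNIV. h w $ i * (z $ i - w $ i) * h z $ i)"
proof -
  obtain T where T: "contractive_matrix T"
    and colligation: "\<forall>z\<in>S. T *v colligation_in z (h z) = colligation_out (f z) (h z)"
    by (rule contractive_interpolation[OF gram])
  obtain A B C D where ABCD: "transpose T = block_matrix A B C D" by (rule block_matrix_cases)
  have "contractive_matrix D"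
    using contractive_matrix_transpose[OF T] unfolding ABCD by (rule contractive_block_matrix)
  hence "w \<in> resolvent_set D" using polydisk_subset_resolvent_set zw(2) S(2) by blast
  define g where "g = colligation_state C D w"
  define d where "d = transfer_function A B C D w"
  have transposed: "transpose T *v colligation_in w g = colligation_out d g"
    unfolding ABCD g_def d_def by (rule colligation_transfer_function) fact
  have diff_d: "f z - d = (\<Sum>i\<in>UNIV. g $ i * (z $ i - w $ i) * h z $ i)" if "z \<in> S" for z
    using colligation_difference[OF _ transposed] colligation that by blast
  have "d = f w" using diff_d[OF zw(2)] by simp
  note diff = diff_d[unfolded this]
  have "g $ i = h w $ i" for i
    using partial_deriv_of_difference_formula[OF S(1) zw(2) cont diff, of i] roots[OF zw(2), of i]
    by auto
  thus ?thesis using diff[OF zw(1)] by simp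
qed

lemma symmetric_unitary_colligation_of_square_roots:
  fixes f :: "complex^'n \<Rightarrow> complex" and h :: "complex^'n \<Rightarrow> complex^'n"
  assumes S: "open S" "convex S" "S \<subseteq> polydisk" and f: "f line_holomorphic_on S"
    and h: "\<And>i. (\<lambda>z. h z $ i) line_holomorphic_on S"
    and roots: "\<And>i z. z \<in> S \<Longrightarrow> h z $ i \<noteq> 0 \<and> h z $ i * h z $ i = partial_deriv i f z"
    and identity: "\<And>z. z \<in> S \<Longrightarrow> schwarz_pick_equality f z"
  obtains U where "unitary_matrix U" "transpose U = U"
    "\<forall>z\<in>S. U *v colligation_in z (h z) = colligation_out (f z) (h z)"
proof -
  have norm_identity:
    "(\<Sum>i\<in>UNIV. (1 - (cmod (z $ i))\<^sup>2) * (cmod (h z $ i))\<^sup>2) = 1 - (cmod (f z))\<^sup>2" if "z \<in> S" for z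
  proof -
    have "cmod (partial_deriv i f z) = (cmod (h z $ i))\<^sup>2" for i
      using roots[OF that, of i] by (metis norm_mult power2_eq_square)
    thus ?thesis using identity[OF that] by (simp add: schwarz_pick_equality_def)
  qed
  have gram: "same_gram_on S (\<lambda>z. colligation_in z (h z)) (\<lambda>z. colligation_out (f z) (h z))"
    by (rule norm_identity_imp_same_gram_on[OF S(1,2) f h norm_identity])
  have sym: "cdot (colligation_in z (h z)) (colligation_out (f w) (h w)) =
      cdot (colligation_in w (h w)) (colligation_out (f z) (h z))" if "z \<in> S" "w \<in> S" for z w
    unfolding cdot_colligation_symmetric_iff
    by (rule difference_formula_of_square_roots[OF S(1,3)
          line_holomorphic_on_imp_continuous_on[OF h] roots gram that])
  show thesis
    by (rule symmetric_unitary_interpolation[OF gram sym]) (assumption+, rule that)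
qed

lemma transfer_function_of_local_colligation:
  fixes f :: "complex^'n \<Rightarrow> complex"
  assumes f: "f line_holomorphic_on polydisk" and U: "unitary_matrix (block_matrix A B C D)"
    and W: "open W" "W \<subseteq> polydisk" "W \<noteq> {}"
    and colligation:
      "\<forall>z\<in>W. block_matrix A B C D *v colligation_in z (h z) = colligation_out (f z) (h z)"
    and z: "z \<in> polydisk"
  shows "f z = transfer_function A B C D z"
proof (rule line_holomorphic_on_analytic_continuation[OF f _ open_polydisk convex_polydisk W _ z])
  note disk = polydisk_subset_resolvent_set_unitary[OF U]
  show "transfer_function A B C D line_holomorphic_on polydisk"
    by (intro line_holomorphic_on_rational rational_on_subset[OF rational_on_transfer_function disk])
  show "f w = transfer_function A B C D w" if "w \<in> W" for w
    using colligation_iff_transfer_function colligation that W(2) disk by blast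
qed

lemma schwarz_pick_equality_imp_realization:
  fixes f :: "complex^'n \<Rightarrow> complex"
  assumes f: "f line_holomorphic_on polydisk"
    and dependence: "\<And>i. \<exists>z\<in>polydisk. partial_deriv i f z \<noteq> 0"
    and identity: "\<And>z. z \<in> polydisk \<Longrightarrow> schwarz_pick_equality f z"
  obtains A B C D where "unitary_matrix (block_matrix A B C D)"
    "transpose (block_matrix A B C D) = block_matrix A B C D"
    "\<forall>z\<in>polydisk. f z = transfer_function A B C D z"
proof -
  note hol = line_holomorphic_on_partial_deriv[OF f open_polydisk]
  have "(0 :: complex^'n) \<in> polydisk" by (simp add: polydisk_def)
  hence "\<exists>z\<in>polydisk. \<forall>i\<in>UNIV. partial_deriv i f z \<noteq> 0"
    by (intro exists_common_nonzero open_polydisk convex_polydisk finite hol dependence) blast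
  then obtain z0 where z0: "z0 \<in> polydisk" "\<And>i. partial_deriv i f z0 \<noteq> 0" by blast
  obtain r h where r: "r > 0" "ball z0 r \<subseteq> polydisk"
    and h: "\<forall>i. (\<lambda>z. h z $ i) line_holomorphic_on ball z0 r"
      "\<forall>z\<in>ball z0 r. \<forall>i. h z $ i \<noteq> 0 \<and> h z $ i * h z $ i = partial_deriv i f z"
    by (rule local_square_roots[OF open_polydisk z0(1) hol z0(2)])
  obtain U where U: "unitary_matrix U" "transpose U = U"
    and colligation: "\<forall>z\<in>ball z0 r. U *v colligation_in z (h z) = colligation_out (f z) (h z)"
    by (rule symmetric_unitary_colligation_of_square_roots[of "ball z0 r" f h,
          OF open_ball convex_ball r(2) line_holomorphic_on_subset[OF f r(2)]])
       (use h identity r(2) in auto)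
  obtain A B C D where ABCD: "U = block_matrix A B C D" by (rule block_matrix_cases)
  have "f z = transfer_function A B C D z" if "z \<in> polydisk" for z
    by (rule transfer_function_of_local_colligation[OF f U(1)[unfolded ABCD] open_ball r(2) _
          colligation[unfolded ABCD] that]) (use r(1) in simp)
  with U show thesis unfolding ABCD using that by blast
qed

theorem theorem1p3:
  fixes f :: "complex^'n \<Rightarrow> complex"
  assumes "f holomorphic_vec_on polydisk"
    and "f ` polydisk \<subseteq> ball 0 1"
    and "\<forall>i. \<exists>z\<in>polydisk. partial_deriv i f z \<noteq> 0"
  shows
    "((\<forall>z\<in>polydisk.
         (\<Sum>i\<in>UNIV. (1 - (cmod (z $ i))\<^sup>2) * cmod (partial_deriv i f z)) = 1 - (cmod (f z))\<^sup>2)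
      \<longleftrightarrow>
      (\<exists>U A B C D. U = block_matrix A B C D \<and> unitary_matrix U \<and> U = transpose U \<and>
         (\<forall>z\<in>polydisk.
            f z = (A + B ** diag_matrix z
                       ** matrix_inv (mat 1 - D ** diag_matrix z) ** C) $ 1 $ 1)))
     \<and>
     ((\<forall>z\<in>polydisk.
         (\<Sum>i\<in>UNIV. (1 - (cmod (z $ i))\<^sup>2) * cmod (partial_deriv i f z)) = 1 - (cmod (f z))\<^sup>2)
      \<longrightarrow> rational_on f polydisk \<and> inner_function f)"
proof -
  let ?identity = "\<forall>z\<in>polydisk. schwarz_pick_equality f z"
  let ?realized = "\<lambda>A B C D. unitary_matrix (block_matrix A B C D) \<and>
    block_matrix A B C D = transpose (block_matrix A B C D) \<and>
    (\<forall>z\<in>polydisk. f z = transfer_function A B C D z)"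
  have "f line_holomorphic_on polydisk"
    using assms(1) open_polydisk by (rule holomorphic_vec_on_imp_line_holomorphic_on)
  hence realization: "\<exists>A B C D. ?realized A B C D" if ?identity
    by (rule schwarz_pick_equality_imp_realization) (use that assms(3) in \<open>blast intro: sym\<close>)+
  have identity: ?identity if "?realized A B C D" for A B C D
    using that by (metis symmetric_unitary_realization_imp_schwarz_pick_equality)
  have regular: "rational_on f polydisk \<and> inner_function f" if "?realized A B C D" for A B C D
    using that rational_on_unitary_realization
      inner_function_unitary_realization[OF _ assms(1) bounded_subset[OF bounded_ball assms(2)]]
    by blast
  show ?thesis
    unfolding schwarz_pick_equality_def[symmetric] transfer_function_def[symmetric]
    using realization identity regular by blast
qed

end
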